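(* Let $\hat A=A_s+A_d\epsilon\in\mathbb{DQ}^{n\times n}$ and let $\lambda_{1s},\dots,\lambda_{ms}\in\mathbb C$ ($m\ge2$) be the distinct standard eigenvalues of $A_s$, with algebraic multiplicities $n_1,\dots,n_m$, ordered so that $|\lambda_{1s}|>|\lambda_{2s}|\ge\cdots\ge|\lambda_{ms}|$. Assume that $\lambda_{1s}\in\mathbb R$ and that $\hat A$ has an eigenvalue $\hat\lambda_1=\lambda_{1s}+\lambda_{1d}\epsilon\in\mathbb{DR}$ with $\mathtt m(\hat\lambda_1,\hat A)=\mathtt m_a(\lambda_{1s},A_s)$. Let $J_i\in\mathbb Q^{n_i\times n_i}$ be the direct sum of the Jordan blocks of $A_s$ with eigenvalue $\lambda_{is}$, let $\hat P\in\mathbb{DQ}^{n\times n}$ be invertible and $H_i\in\mathbb Q^{n_i\times n_i}$ ($i=2,\dots,m$) be such that $\hat P^{-1}\hat A\hat P=\mathrm{diag}(\hat\lambda_1I_{n_1},J_2+H_2\epsilon,\dots,J_m+H_m\epsilon)$ (such matrices exist), and partition $\hat P=(\hat U_1\ \hat U_2\ \cdots\ \hat U_m)$ with $\hat U_i\in\mathbb{DQ}^{n\times n_i}$, so that the columns of $\hat U_1$ are eigenvectors of $\hat A$ corresponding to the strictly dominant eigenvalue $\hat\lambda_1$. Let $\hat{\mathbf v}^{(0)}\in\mathbb{DQ}^n$ be an initial vector, written uniquely as $\hat{\mathbf v}^{(0)}=\sum_{j=1}^m\hat U_j\hat{\boldsymbol\eta}_j$ with $\hat{\boldsymbol\eta}_j\in\mathbb{DQ}^{n_j}$,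 and suppose $\hat{\boldsymbol\eta}_1$ is appreciable. Let $\hat{\mathbf v}^{(k)}$, $\hat\lambda^{(k)}$ be generated by the dual complex adjoint matrix based power method: $\hat B=\mathcal J(\hat A)$, $\hat{\mathbf w}^{(0)}=\mathcal F(\hat{\mathbf v}^{(0)})$, and for $k=1,2,\dots$ $$\hat{\mathbf y}^{(k)}=\hat B\hat{\mathbf w}^{(k-1)},\quad \hat\lambda^{(k-1)}=(\hat{\mathbf w}^{(k-1)})^*\hat{\mathbf y}^{(k)},\quad \hat{\mathbf w}^{(k)}=\frac{\hat{\mathbf y}^{(k)}}{\|\hat{\mathbf y}^{(k)}\|_2},\quad \hat{\mathbf v}^{(k)}=\mathcal F^{-1}(\hat{\mathbf w}^{(k)}).$$ Then $$\hat{\mathbf v}^{(k)}=\frac{\hat U_1\hat{\boldsymbol\eta}_1}{\|\hat U_1\hat{\boldsymbol\eta}_1\|_2}\left(\frac{\hat\lambda_1}{|\hat\lambda_1|}\right)^k\left(1+\tilde O_D\!\left(\left|\frac{\lambda_{2s}}{\lambda_{1s}}\right|^k\right)\right)$$ and $$\hat\lambda^{(k)}=\hat\lambda_1\left(1+\tilde O_D\!\left(\left|\frac{\lambda_{2s}}{\lambda_{1s}}\right|^k\right)\right).$$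
   Context: $\mathbb{Q}$ denotes the quaternions and $\mathbb{DQ}$ the dual quaternions $q_s+q_d\epsilon$, $q_s,q_d\in\mathbb Q$, where $\epsilon\neq0$, $\epsilon^2=0$ and $\epsilon$ commutes with quaternions; $q_s$ is the standard part, $q_d$ the dual part. $\mathbb{DR}$ (dual numbers) and $\mathbb{DC}$ (dual complex numbers) are the elements with both parts in $\mathbb R$, resp. $\mathbb C$. Conjugation is $\hat q^*=q_s^*+q_d^*\epsilon$, and $^*$ on vectors and matrices is conjugate transpose. Vectors and matrices are written $\hat{\mathbf x}=\mathbf x_s+\mathbf x_d\epsilon$, $\hat A=A_s+A_d\epsilon$. An element or vector is appreciable if its standard part is nonzero. Division by a dual number with positive standard part means multiplication by its inverse. Magnitude and norm: for $q_s\ne0$, $|\hat q|=|q_s|+\frac{q_s^*q_d+q_d^*q_s}{2|q_s|}\epsilon$, and $|q_d\epsilon|=|q_d|\epsilon$. For $\mathbf x_s\ne0$, $\|\hat{\mathbf x}\|_2=\|\mathbf x_s\|_2+\frac{\mathbf x_s^*\mathbf x_d+\mathbf x_d^*\mathbf x_s}{2\|\mathbf x_s\|_2}\epsilon$, and $\|\mathbf x_d\epsilon\|_2=\|\mathbf x_d\|_2\epsilon$. Eigenvalues: $\hat\lambda\in\mathbb{DQ}$ is a (right) eigenvalue of $\hat A$ with eigenvector $\hat{\mathbf x}$ if $\hat A\hat{\mathbf x}=\hat{\mathbf x}\hat\lambda$ with $\hat{\mathbf x}$ appreciable. Dual quaternion vectors are appreciably linearly independent if their standard parts are right linearly independent over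 $\mathbb Q$. $\mathtt m(\hat\lambda,\hat A)$ is the cardinality of a maximal set of appreciably linearly independent eigenvectors in $\{\hat{\mathbf x}\in\mathbb{DQ}^n:\hat A\hat{\mathbf x}=\hat{\mathbf x}\hat\lambda\}$. An eigenvalue $\hat\lambda_1$ is strictly dominant, with multiplicity $n_1$, if $|\lambda_{1s}|>|\mu_s|$ for every other eigenvalue $\hat\mu=\mu_s+\mu_d\epsilon$ of $\hat A$ and $\mathtt m(\hat\lambda_1,\hat A)=n_1$. For a quaternion matrix, a standard eigenvalue is a right eigenvalue that is a complex number with nonnegative imaginary part; every quaternion square matrix is similar (via an invertible quaternion matrix) to a direct sum of upper Jordan blocks with standard eigenvalues on the diagonal, unique up to order. $\mathtt m_a(\lambda,A)$ (algebraic multiplicity) is the sum of sizes of the Jordan blocks for $\lambda$. Adjoint: with $\mathbf i,\mathbf j,\mathbf k$ the quaternion units and $\mathbb C=\mathbb R+\mathbb R\mathbf i$, for $\hat Q=(A_1+A_2\mathbf j)+(A_3+A_4\mathbf j)\epsilon\in\mathbb{DQ}^{n\times n}$ with $A_i\in\mathbb C^{n\times n}$, $$\mathcal J(\hat Q)=\begin{pmatrix}A_1&A_2\\-\overline{A_2}&\overline{A_1}\end{pmatrix}+\begin{pmatrix}A_3&A_4\\-\overline{A_4}&\overline{A_3}\end{pmatrix}\epsilon\in\mathbb{DC}^{2n\times2n},$$ and for $\hat{\mathbf v}=(\mathbf v_1+\mathbf v_2\mathbf j)+(\mathbf v_3+\mathbf v_4\mathbf j)\epsilon\in\mathbb{DQ}^n$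 with $\mathbf v_i\in\mathbb C^n$, $$\mathcal F(\hat{\mathbf v})=\begin{pmatrix}\mathbf v_1\\-\overline{\mathbf v}_2\end{pmatrix}+\begin{pmatrix}\mathbf v_3\\-\overline{\mathbf v}_4\end{pmatrix}\epsilon\in\mathbb{DC}^{2n},$$ a bijection $\mathbb{DQ}^n\to\mathbb{DC}^{2n}$ with inverse $\mathcal F^{-1}$. Asymptotics (as $k\to\infty$): for real $c\ge0$, a real sequence $c_k$ is $\tilde O(c^k)$ if $c_k=O(c^kh(k))$ for some polynomial $h$. A sequence $\hat a_k=a_{ks}+a_{kd}\epsilon$ is $\tilde O_D(c^k)$ if $a_{ks}=\tilde O(c^k)$ and $a_{kd}=\tilde O(c^k)$ (in magnitude). *)

theory Defs
  imports
    "HOL-Analysis.Product_Vector"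
    "HOL-Analysis.L2_Norm"
    "HOL-Library.Landau_Symbols"
    "HOL-Computational_Algebra.Polynomial"
    "Jordan_Normal_Form.Jordan_Normal_Form"
begin

section \<open>Quaternions\<close>

text \<open>\<open>Quat a b\<close> is the quaternion \<open>a + b j\<close> with \<open>a, b\<close> in \<open>\<complex> = \<real> + \<real> i\<close>;
  the product is determined by \<open>j z = cnj z j\<close> and \<open>j\<^sup>2 = -1\<close>.\<close>

datatype quat = Quat (quat1: complex) (quat2: complex)

lemma quat_eq_iff: "p = q \<longleftrightarrow> quat1 p = quat1 q \<and> quat2 p = quat2 q"
  by (auto intro: quat.expand)

instantiation quat :: ring_1
begin
definition "0 = Quat 0 0"
definition "1 = Quat 1 0"
definition "p + q = Quat (quat1 p + quat1 q) (quat2 p + quat2 q)"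
definition "- q = Quat (- quat1 q) (- quat2 q)"
definition "p - q = Quat (quat1 p - quat1 q) (quat2 p - quat2 q)"
definition "p * q = Quat (quat1 p * quat1 q - quat2 p * cnj (quat2 q))
                         (quat1 p * quat2 q + quat2 p * cnj (quat1 q))"
instance
  by standard (auto simp: quat_eq_iff zero_quat_def one_quat_def plus_quat_def
      uminus_quat_def minus_quat_def times_quat_def algebra_simps)
end

lemma quat_sel [simp]:
  "quat1 0 = 0" "quat2 0 = 0" "quat1 1 = 1" "quat2 1 = 0"
  "quat1 (p + q) = quat1 p + quat1 q" "quat2 (p + q) = quat2 p + quat2 q"
  "quat1 (- q) = - quat1 q" "quat2 (- q) = - quat2 q"
  "quat1 (p - q) = quat1 p - quat1 q" "quat2 (p - q) = quat2 p - quat2 q"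
  "quat1 (p * q) = quat1 p * quat1 q - quat2 p * cnj (quat2 q)"
  "quat2 (p * q) = quat1 p * quat2 q + quat2 p * cnj (quat1 q)"
  by (simp_all add: zero_quat_def one_quat_def plus_quat_def
      uminus_quat_def minus_quat_def times_quat_def)

lemma quat_units:
  defines "I \<equiv> Quat \<i> 0" and "J \<equiv> Quat 0 1" and "K \<equiv> Quat 0 \<i>"
  shows "I * I = - 1" "J * J = - 1" "K * K = - 1"
    "I * J = K" "J * K = I" "K * I = J" "J * I = - K" "K * J = - I" "I * K = - J"
  by (simp_all add: quat_eq_iff I_def J_def K_def)

instantiation quat :: conjugate
begin
definition "conjugate q = Quat (cnj (quat1 q)) (- quat2 q)"
instance
  by standard (auto simp: quat_eq_iff conjugate_quat_def)
end

lemma conjugate_quat_sel [simp]: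
  "quat1 (conjugate q) = cnj (quat1 q)" "quat2 (conjugate q) = - quat2 q"
  by (simp_all add: conjugate_quat_def)

lemma conjugate_quat_mult: "conjugate (p * q) = conjugate q * conjugate (p :: quat)"
  by (simp add: quat_eq_iff)

instantiation quat :: scaleR
begin
definition "scaleR r q = Quat (of_real r * quat1 q) (of_real r * quat2 q)"
instance ..
end

instantiation quat :: real_normed_div_algebra
begin

definition "norm q = sqrt ((cmod (quat1 q))\<^sup>2 + (cmod (quat2 q))\<^sup>2)"
definition "dist (p :: quat) q = norm (p - q)"
definition "sgn (q :: quat) = q /\<^sub>R norm q"
definition "inverse (q :: quat) = conjugate q /\<^sub>R (norm q)\<^sup>2"
definition "(p :: quat) div q = p * inverse q"
definition [code del]:
  "(uniformity :: (quat \<times> quat) filter) = (INF e\<in>{0 <..}. principal {(x, y). dist x y < e})"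
definition [code del]:
  "open (U :: quat set) \<longleftrightarrow> (\<forall>x\<in>U. eventually (\<lambda>(x', y). x' = x \<longrightarrow> y \<in> U) uniformity)"

lemma scaleR_quat_sel [simp]:
  "quat1 (r *\<^sub>R q) = of_real r * quat1 q" "quat2 (r *\<^sub>R q) = of_real r * quat2 q"
  by (simp_all add: scaleR_quat_def)

lemma norm_quat_pair: "norm q = norm (quat1 q, quat2 q)"
  by (simp add: norm_quat_def norm_Pair)

lemma quat_mult_conjugate:
  "q * conjugate q = Quat (of_real ((norm q)\<^sup>2)) 0" "conjugate q * q = Quat (of_real ((norm q)\<^sup>2)) 0"
  by (simp_all add: quat_eq_iff norm_quat_def complex_norm_square mult.commute del: of_real_power)

lemma norm_quat_eq_0: "norm (q :: quat) = 0 \<longleftrightarrow> q = 0"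
  by (simp add: norm_quat_def quat_eq_iff sum_power2_eq_zero_iff)

instance
proof
  fix p q :: quat and a b :: real
  show "dist p q = norm (p - q)" by (rule dist_quat_def)
  show "sgn q = q /\<^sub>R norm q" by (rule sgn_quat_def)
  show "(uniformity :: (quat \<times> quat) filter) = (INF e\<in>{0 <..}. principal {(x, y). dist x y < e})"
    by (rule uniformity_quat_def)
  show "open U \<longleftrightarrow> (\<forall>x\<in>U. eventually (\<lambda>(x', y). x' = x \<longrightarrow> y \<in> U) uniformity)" for U :: "quat set"
    by (rule open_quat_def)
  show "p div q = p * inverse q" by (rule divide_quat_def)
  show "inverse (0 :: quat) = 0" by (simp add: inverse_quat_def quat_eq_iff)
  show "norm q = 0 \<longleftrightarrow> q = 0" by (rule norm_quat_eq_0)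
  show "norm (p + q) \<le> norm p + norm q"
    using norm_triangle_ineq[of "(quat1 p, quat2 p)" "(quat1 q, quat2 q)"]
    by (simp add: norm_quat_pair)
  show "norm (a *\<^sub>R q) = \<bar>a\<bar> * norm q"
    by (simp add: norm_quat_def norm_mult power_mult_distrib real_sqrt_mult flip: distrib_left)
  show "a *\<^sub>R (p + q) = a *\<^sub>R p + a *\<^sub>R q" "(a + b) *\<^sub>R q = a *\<^sub>R q + b *\<^sub>R q"
    "a *\<^sub>R b *\<^sub>R q = (a * b) *\<^sub>R q" "1 *\<^sub>R q = q"
    "a *\<^sub>R p * q = a *\<^sub>R (p * q)" "p * a *\<^sub>R q = a *\<^sub>R (p * q)"
    by (simp_all add: quat_eq_iff algebra_simps)
  show "norm (p * q) = norm p * norm q"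
  proof -
    have "complex_of_real ((norm (p * q))\<^sup>2) = complex_of_real ((norm p * norm q)\<^sup>2)"
      unfolding norm_quat_def power_mult_distrib
      by (simp add: complex_norm_square algebra_simps del: of_real_power)
    then have "(norm (p * q))\<^sup>2 = (norm p * norm q)\<^sup>2"
      using of_real_eq_iff by blast
    then show ?thesis
      by (rule power2_eq_imp_eq) (simp_all add: norm_quat_def)
  qed
  show "inverse q * q = 1" "q * inverse q = 1" if "q \<noteq> 0"
  proof -
    have n: "norm q \<noteq> 0" using that by (simp add: norm_quat_eq_0)
    have a: "(conjugate q /\<^sub>R r) * q = (conjugate q * q) /\<^sub>R r"
      "q * (conjugate q /\<^sub>R r) = (q * conjugate q) /\<^sub>R r" for r
      by (simp_all add: quat_eq_iff algebra_simps)
    show "inverse q * q = 1" "q * inverse q = 1"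
      unfolding inverse_quat_def a quat_mult_conjugate using n
      by (simp_all add: quat_eq_iff)
  qed
qed

end

definition quat_of_complex :: "complex \<Rightarrow> quat" where
  "quat_of_complex z = Quat z 0"


section \<open>Dual numbers over a ring\<close>

text \<open>\<open>Dualnum a b\<close> is \<open>a + b \<epsilon>\<close>.  The dual quaternions are \<open>quat dualnum\<close> and the dual complex
  numbers are \<open>complex dualnum\<close>.\<close>

datatype 'a dualnum = Dualnum (std_part: 'a) (dual_part: 'a)

lemma dualnum_eq_iff: "x = y \<longleftrightarrow> std_part x = std_part y \<and> dual_part x = dual_part y"
  by (auto intro: dualnum.expand)

instantiation dualnum :: (ring_1) ring_1
begin
definition "0 = Dualnum 0 0"
definition "1 = Dualnum 1 0"
definition "x + y = Dualnum (std_part x + std_part y) (dual_part x + dual_part y)"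
definition "- x = Dualnum (- std_part x) (- dual_part x)"
definition "x - y = Dualnum (std_part x - std_part y) (dual_part x - dual_part y)"
definition "x * y = Dualnum (std_part x * std_part y)
                            (std_part x * dual_part y + dual_part x * std_part y)"
instance
  by standard (auto simp: dualnum_eq_iff zero_dualnum_def one_dualnum_def plus_dualnum_def
      uminus_dualnum_def minus_dualnum_def times_dualnum_def algebra_simps)
end

lemma dualnum_sel [simp]:
  "std_part 0 = 0" "dual_part 0 = 0" "std_part 1 = 1" "dual_part 1 = 0"
  "std_part (x + y) = std_part x + std_part y" "dual_part (x + y) = dual_part x + dual_part y"
  "std_part (- x) = - std_part x" "dual_part (- x) = - dual_part x"
  "std_part (x - y) = std_part x - std_part y" "dual_part (x - y) = dual_part x - dual_part y"
  "std_part (x * y) = std_part x * std_part y"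
  "dual_part (x * y) = std_part x * dual_part y + dual_part x * std_part y"
  by (simp_all add: zero_dualnum_def one_dualnum_def plus_dualnum_def
      uminus_dualnum_def minus_dualnum_def times_dualnum_def)

instantiation dualnum :: (division_ring) inverse
begin
definition "inverse x = Dualnum (inverse (std_part x))
  (- (inverse (std_part x) * dual_part x * inverse (std_part x)))"
definition "x div y = x * inverse (y :: 'a dualnum)"
instance ..
end

lemma dualnum_inverse:
  fixes x :: "'a :: division_ring dualnum"
  assumes "std_part x \<noteq> 0"
  shows "x * inverse x = 1" "inverse x * x = 1"
  using assms by (simp_all add: dualnum_eq_iff inverse_dualnum_def mult.assoc)
    (simp_all flip: mult.assoc)

instantiation dualnum :: (conjugate) conjugate
begin
definition "conjugate x = Dualnum (conjugate (std_part x)) (conjugate (dual_part x))"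
instance
  by standard (auto simp: dualnum_eq_iff conjugate_dualnum_def)
end

text \<open>The dual (real) numbers as elements of \<open>'a dualnum\<close>.\<close>

definition Dual_Reals :: "'a :: real_algebra_1 dualnum set" where
  "Dual_Reals = {x. std_part x \<in> \<real> \<and> dual_part x \<in> \<real>}"

definition DQ_of_DC :: "complex dualnum \<Rightarrow> quat dualnum" where
  "DQ_of_DC = map_dualnum quat_of_complex"


section \<open>Vectors and matrices of dual numbers\<close>

abbreviation std_vec :: "'a dualnum vec \<Rightarrow> 'a vec" where
  "std_vec \<equiv> map_vec std_part"

abbreviation dual_vec :: "'a dualnum vec \<Rightarrow> 'a vec" where
  "dual_vec \<equiv> map_vec dual_part"

abbreviation std_mat :: "'a dualnum mat \<Rightarrow> 'a mat" where
  "std_mat \<equiv> map_mat std_part"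

abbreviation dual_mat :: "'a dualnum mat \<Rightarrow> 'a mat" where
  "dual_mat \<equiv> map_mat dual_part"

text \<open>\<open>mk_dual_vec x y = x + y \<epsilon>\<close> and \<open>mk_dual_mat A B = A + B \<epsilon>\<close>, for arguments of equal dimension.\<close>

definition mk_dual_vec :: "'a vec \<Rightarrow> 'a vec \<Rightarrow> 'a dualnum vec" where
  "mk_dual_vec x y = vec (dim_vec x) (\<lambda>i. Dualnum (x $ i) (y $ i))"

definition mk_dual_mat :: "'a mat \<Rightarrow> 'a mat \<Rightarrow> 'a dualnum mat" where
  "mk_dual_mat A B = mat (dim_row A) (dim_col A) (\<lambda>ij. Dualnum (A $$ ij) (B $$ ij))"

definition appreciable_vec :: "'a :: zero dualnum vec \<Rightarrow> bool" where
  "appreciable_vec x \<longleftrightarrow> std_vec x \<noteq> 0\<^sub>v (dim_vec x)"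

definition vec_rscale :: "'a :: times vec \<Rightarrow> 'a \<Rightarrow> 'a vec" (infixl "\<cdot>\<^sub>r" 70) where
  "x \<cdot>\<^sub>r q = map_vec (\<lambda>a. a * q) x"

definition norm2 :: "'a :: real_normed_vector vec \<Rightarrow> real" where
  "norm2 x = L2_set (\<lambda>i. norm (x $ i)) {..<dim_vec x}"

text \<open>Magnitude and norm take values in the dual real numbers inside \<open>'a dualnum\<close>.  They are used
  for quaternions and complex numbers, on which \<open>x\<^sup>* y + y\<^sup>* x\<close> is real.\<close>

definition dual_abs :: "'a :: {real_normed_algebra_1, conjugate} dualnum \<Rightarrow> 'a dualnum" where
  "dual_abs q =
    (let s = std_part q; d = dual_part q in
     if s \<noteq> 0
     then Dualnum (of_real (norm s)) ((conjugate s * d + conjugate d * s) /\<^sub>R (2 * norm s))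
     else Dualnum 0 (of_real (norm d)))"

definition dual_norm2 :: "'a :: {real_normed_algebra_1, conjugate} dualnum vec \<Rightarrow> 'a dualnum" where
  "dual_norm2 x =
    (let s = std_vec x; d = dual_vec x in
     if appreciable_vec x
     then Dualnum (of_real (norm2 s))
            ((scalar_prod (conjugate s) d + scalar_prod (conjugate d) s) /\<^sub>R (2 * norm2 s))
     else Dualnum 0 (of_real (norm2 d)))"


section \<open>Eigenvalues\<close>

definition dq_eigenvector :: "quat dualnum mat \<Rightarrow> quat dualnum vec \<Rightarrow> quat dualnum \<Rightarrow> bool" where
  "dq_eigenvector A x l \<longleftrightarrow>
     x \<in> carrier_vec (dim_row A) \<and> appreciable_vec x \<and> A *\<^sub>v x = x \<cdot>\<^sub>r l"

definition dq_eigenvalue :: "quat dualnum mat \<Rightarrow> quat dualnum \<Rightarrow> bool" where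
  "dq_eigenvalue A l \<longleftrightarrow> (\<exists>x. dq_eigenvector A x l)"

text \<open>Indexing the family of standard parts by \<open>S\<close> makes two vectors that differ only in their dual
  parts dependent.\<close>

definition apprec_lin_indep :: "nat \<Rightarrow> quat dualnum vec set \<Rightarrow> bool" where
  "apprec_lin_indep n S \<longleftrightarrow> finite S \<and> S \<subseteq> carrier_vec n \<and>
     (\<forall>c :: quat dualnum vec \<Rightarrow> quat.
        (\<forall>r<n. (\<Sum>x\<in>S. std_vec x $ r * c x) = 0) \<longrightarrow> (\<forall>x\<in>S. c x = 0))"

text \<open>All inclusion-maximal such sets have the same cardinality, as their standard parts are bases of
  one right subspace; so this is the cardinality of any maximal set.\<close>

definition dq_mult :: "quat dualnum \<Rightarrow> quat dualnum mat \<Rightarrow> nat" where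
  "dq_mult l A =
     Max {card S |S. (\<forall>x\<in>S. dq_eigenvector A x l) \<and> apprec_lin_indep (dim_row A) S}"

definition standard_eigenvalues :: "quat mat \<Rightarrow> complex set" where
  "standard_eigenvalues A =
     {l. Im l \<ge> 0 \<and> (\<exists>x \<in> carrier_vec (dim_row A). x \<noteq> 0\<^sub>v (dim_row A) \<and>
                        A *\<^sub>v x = x \<cdot>\<^sub>r quat_of_complex l)}"

text \<open>\<open>bs\<close> lists the blocks as pairs (size, eigenvalue), as in \<open>jordan_nf\<close>.\<close>

definition quat_jordan_form :: "quat mat \<Rightarrow> (nat \<times> complex) list \<Rightarrow> bool" where
  "quat_jordan_form A bs \<longleftrightarrow>
     jordan_nf A (map (apsnd quat_of_complex) bs) \<and> (\<forall>(s, l) \<in> set bs. Im l \<ge> 0)"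

definition blocks_of :: "complex \<Rightarrow> (nat \<times> complex) list \<Rightarrow> (nat \<times> complex) list" where
  "blocks_of l bs = filter (\<lambda>(s, l'). l' = l) bs"

text \<open>The algebraic multiplicity; the choice of \<open>bs\<close> is immaterial, as the Jordan form is unique
  up to the order of its blocks.\<close>

definition quat_alg_mult :: "complex \<Rightarrow> quat mat \<Rightarrow> nat" where
  "quat_alg_mult l A = sum_list (map fst (blocks_of l (SOME bs. quat_jordan_form A bs)))"

definition jordan_part :: "complex \<Rightarrow> (nat \<times> complex) list \<Rightarrow> quat mat" where
  "jordan_part l bs = jordan_matrix (map (apsnd quat_of_complex) (blocks_of l bs))"


section \<open>The dual complex adjoint\<close>

definition quat_mat_adj :: "quat mat \<Rightarrow> complex mat" where
  "quat_mat_adj A = four_block_mat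
     (map_mat quat1 A) (map_mat quat2 A)
     (map_mat (\<lambda>q. - cnj (quat2 q)) A) (map_mat (\<lambda>q. cnj (quat1 q)) A)"

definition dq_adjoint :: "quat dualnum mat \<Rightarrow> complex dualnum mat" where
  "dq_adjoint Q = mk_dual_mat (quat_mat_adj (std_mat Q)) (quat_mat_adj (dual_mat Q))"

definition quat_vec_adj :: "quat vec \<Rightarrow> complex vec" where
  "quat_vec_adj v = map_vec quat1 v @\<^sub>v map_vec (\<lambda>q. - cnj (quat2 q)) v"

definition dq_vec_adj :: "quat dualnum vec \<Rightarrow> complex dualnum vec" where
  "dq_vec_adj v = mk_dual_vec (quat_vec_adj (std_vec v)) (quat_vec_adj (dual_vec v))"

lemma bij_betw_dq_vec_adj: "bij_betw dq_vec_adj (carrier_vec n) (carrier_vec (2 * n))"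
proof (rule bij_betw_byWitness[where f' = "\<lambda>w. vec n (\<lambda>i. Dualnum
    (Quat (std_part (w $ i)) (- cnj (std_part (w $ (n + i)))))
    (Quat (dual_part (w $ i)) (- cnj (dual_part (w $ (n + i))))))"])
qed (auto simp: dq_vec_adj_def mk_dual_vec_def quat_vec_adj_def append_vec_def dualnum_eq_iff
    quat_eq_iff Let_def intro!: eq_vecI)

definition dq_vec_adj_inv :: "nat \<Rightarrow> complex dualnum vec \<Rightarrow> quat dualnum vec" where
  "dq_vec_adj_inv n = inv_into (carrier_vec n) dq_vec_adj"


section \<open>Asymptotics\<close>

definition Otilde :: "real \<Rightarrow> (nat \<Rightarrow> real) \<Rightarrow> bool" where
  "Otilde c f \<longleftrightarrow> (\<exists>h :: real poly. f \<in> O(\<lambda>k. c ^ k * poly h (real k)))"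

definition Otilde_D :: "real \<Rightarrow> (nat \<Rightarrow> 'a :: real_normed_vector dualnum) \<Rightarrow> bool" where
  "Otilde_D c a \<longleftrightarrow>
     Otilde c (\<lambda>k. norm (std_part (a k))) \<and> Otilde c (\<lambda>k. norm (dual_part (a k)))"

definition Otilde_D_vec :: "real \<Rightarrow> (nat \<Rightarrow> 'a :: real_normed_vector dualnum vec) \<Rightarrow> bool" where
  "Otilde_D_vec c a \<longleftrightarrow>
     Otilde c (\<lambda>k. norm2 (std_vec (a k))) \<and> Otilde c (\<lambda>k. norm2 (dual_vec (a k)))"

end

theory Submission
  imports Defs "HOL-Real_Asymp.Real_Asymp"
begin

text \<open>
  The normalization in the power method only ever divides by dual real numbers, and these are
  central.  So for \<open>k \<ge> 1\<close> the iterate \<open>v\<^sub>k\<close> is the normalization of \<open>A\<^sup>k v\<^sub>0\<close>, and the proof has two independent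
  parts: how fast the direction of \<open>A\<^sup>k v\<^sub>0\<close> settles, and how normalization transports that rate.

  For the direction, put \<open>D = P\<^sup>-\<^sup>1 A P\<close> and divide out the dominant eigenvalue in every step:
  \<open>X\<^sub>k = A\<^sup>k v\<^sub>0 \<lambda>\<^sub>1\<^sup>-\<^sup>k = P (D \<lambda>\<^sub>1\<^sup>-\<^sup>1)\<^sup>k P\<^sup>-\<^sup>1 v\<^sub>0\<close>.  On the first block \<open>D \<lambda>\<^sub>1\<^sup>-\<^sup>1\<close> is the identity, so these
  coordinates keep the value \<open>\<eta>\<^sub>1\<close>.  On the remaining coordinates the standard part of \<open>D \<lambda>\<^sub>1\<^sup>-\<^sup>1\<close> is
  upper triangular with diagonal entries of norm at most \<open>c = |\<lambda>\<^sub>2 / \<lambda>\<^sub>1|\<close>.  The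
  triangular recursion is solved from the last coordinate upwards: each coordinate satisfies a scalar inequality \<open>a\<^sub>k\<^sub>+\<^sub>1 \<le> c a\<^sub>k + b\<^sub>k\<close> whose perturbation \<open>b\<^sub>k\<close> is already known
  to be of order \<open>c\<^sup>k\<close> up to a polynomial, and \<open>Otilde_recurrence\<close> passes this bound to \<open>a\<^sub>k\<close>.  The dual
  parts obey the same recursion with a further perturbation coming from the standard parts.
  Hence \<open>X\<^sub>k\<close> converges to \<open>U\<^sub>1 \<eta>\<^sub>1\<close> at the rate \<open>c\<close> (\<open>block_diagonal_power_iteration\<close>).

  For the normalization, sequences that converge at a rate \<open>c < 1\<close> are closed under sums, products
  and \<open>a \<mapsto> 1 / sqrt a\<close> away from \<open>0\<close>.  The inverse of the dual norm of \<open>x\<close> is the dual number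
  \<open>(x\<^sup>* x)\<^sup>-\<^sup>1\<^sup>/\<^sup>2\<close>, so everything reduces to these operations.  Normalizing \<open>X\<^sub>k \<lambda>\<^sub>1\<^sup>k\<close> instead of \<open>X\<^sub>k\<close>
  only changes the sign by \<open>(\<lambda>\<^sub>1 / |\<lambda>\<^sub>1|)\<^sup>k\<close>, a sign that cancels in the quadratic form
  \<open>v\<^sub>k\<^sup>* A v\<^sub>k\<close> defining the eigenvalue estimates (\<open>normalized_iteration_limit\<close>).

  Finally the method runs on complex vectors, but \<open>dq_vec_adj\<close> intertwines \<open>A\<close> with \<open>dq_adjoint A\<close>,
  commutes with scaling by dual reals and preserves norms, so it carries the quaternionic iteration
  to the complex one (\<open>adjoint_power_method\<close>); inner products become the complex components of the
  quaternionic ones.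
\<close>


section \<open>Geometric rates up to polynomial factors\<close>

lemma poly_le_power:
  fixes h :: "real poly"
  shows "\<exists>C\<ge>0. \<forall>x\<ge>0. \<bar>poly h x\<bar> \<le> C * (1 + x) ^ degree h"
proof (intro exI conjI allI impI)
  show "(\<Sum>i\<le>degree h. \<bar>coeff h i\<bar>) \<ge> 0" by (simp add: sum_nonneg)
  fix x :: real assume x: "x \<ge> 0"
  have "\<bar>poly h x\<bar> \<le> (\<Sum>i\<le>degree h. \<bar>coeff h i * x ^ i\<bar>)"
    unfolding poly_altdef by (rule sum_abs)
  also have "\<dots> \<le> (\<Sum>i\<le>degree h. \<bar>coeff h i\<bar> * (1 + x) ^ degree h)"
  proof (rule sum_mono)
    fix i assume "i \<in> {..degree h}"
    then have "x ^ i \<le> (1 + x) ^ degree h"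
      using x by (intro order.trans[OF power_mono[of x "1 + x" i]] power_increasing) auto
    then show "\<bar>coeff h i * x ^ i\<bar> \<le> \<bar>coeff h i\<bar> * (1 + x) ^ degree h"
      using x by (simp add: abs_mult mult_left_mono)
  qed
  finally show "\<bar>poly h x\<bar> \<le> (\<Sum>i\<le>degree h. \<bar>coeff h i\<bar>) * (1 + x) ^ degree h"
    by (simp add: sum_distrib_right)
qed

text \<open>Among the polynomial factors the powers of \<open>1 + k\<close> suffice.  Unlike general polynomials they are
  positive and increasing, which makes the bounds add, multiply and propagate through recursions.\<close>

lemma Otilde_iff:
  assumes "0 \<le> c"
  shows "Otilde c f \<longleftrightarrow>
    (\<exists>C\<ge>0. \<exists>N. eventually (\<lambda>k. \<bar>f k\<bar> \<le> C * (c ^ k * (1 + real k) ^ N)) sequentially)"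
proof
  assume "Otilde c f"
  then obtain h :: "real poly" where "f \<in> O(\<lambda>k. c ^ k * poly h (real k))"
    unfolding Otilde_def by blast
  then obtain D where D: "D > 0"
    and f: "eventually (\<lambda>k. \<bar>f k\<bar> \<le> D * (c ^ k * \<bar>poly h (real k)\<bar>)) sequentially"
    using assms by (auto elim!: landau_o.bigE simp: abs_mult power_abs)
  obtain C where C: "C \<ge> 0" "\<And>x. x \<ge> 0 \<Longrightarrow> \<bar>poly h x\<bar> \<le> C * (1 + x) ^ degree h"
    using poly_le_power[of h] by blast
  have "eventually (\<lambda>k. \<bar>f k\<bar> \<le> (D * C) * (c ^ k * (1 + real k) ^ degree h)) sequentially"
    using f
  proof eventually_elim
    case (elim k)
    have "D * (c ^ k * \<bar>poly h (real k)\<bar>) \<le> D * (c ^ k * (C * (1 + real k) ^ degree h))"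
      using D assms C(2)[of "real k"] by (intro mult_left_mono) auto
    with elim show ?case by (simp add: mult_ac)
  qed
  then show "\<exists>C\<ge>0. \<exists>N. eventually (\<lambda>k. \<bar>f k\<bar> \<le> C * (c ^ k * (1 + real k) ^ N)) sequentially"
    using C D by (intro exI[of _ "D * C"] conjI exI[of _ "degree h"]) auto
next
  assume "\<exists>C\<ge>0. \<exists>N. eventually (\<lambda>k. \<bar>f k\<bar> \<le> C * (c ^ k * (1 + real k) ^ N)) sequentially"
  then obtain C N where
    f: "eventually (\<lambda>k. \<bar>f k\<bar> \<le> C * (c ^ k * (1 + real k) ^ N)) sequentially" by blast
  have "f \<in> O(\<lambda>k. c ^ k * poly ([:1, 1:] ^ N) (real k))"
  proof (rule landau_o.bigI)
    show "eventually (\<lambda>k. norm (f k) \<le> max C 1 * norm (c ^ k * poly ([:1, 1:] ^ N) (real k))) sequentially"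
      using f
    proof eventually_elim
      case (elim k)
      have "C * (c ^ k * (1 + real k) ^ N) \<le> max C 1 * (c ^ k * (1 + real k) ^ N)"
        using assms by (intro mult_right_mono) auto
      with elim show ?case using assms by (simp add: poly_power abs_mult power_abs)
    qed
  qed auto
  then show "Otilde c f" unfolding Otilde_def by blast
qed

lemma Otilde_mono:
  assumes "0 \<le> c" "Otilde c g" "eventually (\<lambda>k. \<bar>f k\<bar> \<le> \<bar>g k\<bar>) sequentially"
  shows "Otilde c f"
proof -
  obtain h :: "real poly" where "g \<in> O(\<lambda>k. c ^ k * poly h (real k))"
    using assms unfolding Otilde_def by blast
  moreover have "f \<in> O(g)"
    using assms(3) by (intro landau_o.bigI[of 1]) auto
  ultimately show ?thesis unfolding Otilde_def using landau_o.big_trans by blast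
qed

lemma Otilde_zero: "Otilde c (\<lambda>k. 0)"
  unfolding Otilde_def by auto

lemma Otilde_cmult: "Otilde c f \<Longrightarrow> Otilde c (\<lambda>k. a * f k)"
  unfolding Otilde_def by (cases "a = 0") auto

lemma Otilde_add:
  assumes "0 \<le> c" "Otilde c f" "Otilde c g"
  shows "Otilde c (\<lambda>k. f k + g k)"
proof -
  obtain C M where C: "C \<ge> 0"
    and f: "eventually (\<lambda>k. \<bar>f k\<bar> \<le> C * (c ^ k * (1 + real k) ^ M)) sequentially"
    using assms(1,2) by (auto simp: Otilde_iff)
  obtain D N where D: "D \<ge> 0"
    and g: "eventually (\<lambda>k. \<bar>g k\<bar> \<le> D * (c ^ k * (1 + real k) ^ N)) sequentially"
    using assms(1,3) by (auto simp: Otilde_iff)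
  have "eventually (\<lambda>k. \<bar>f k + g k\<bar> \<le> (C + D) * (c ^ k * (1 + real k) ^ (M + N))) sequentially"
    using f g
  proof eventually_elim
    case (elim k)
    have "C * (c ^ k * (1 + real k) ^ M) \<le> C * (c ^ k * (1 + real k) ^ (M + N))"
      using C assms(1) by (intro mult_left_mono power_increasing) auto
    moreover have "D * (c ^ k * (1 + real k) ^ N) \<le> D * (c ^ k * (1 + real k) ^ (M + N))"
      using D assms(1) by (intro mult_left_mono power_increasing) auto
    ultimately show ?case using elim by (simp add: distrib_right)
  qed
  then show ?thesis unfolding Otilde_iff[OF assms(1)]
    using C D by (intro exI[of _ "C + D"] conjI exI[of _ "M + N"]) auto
qed

lemma Otilde_sum:
  assumes "0 \<le> c" "\<And>i. i \<in> I \<Longrightarrow> Otilde c (f i)"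
  shows "Otilde c (\<lambda>k. \<Sum>i\<in>I. f i k)"
  using assms(2) by (induction I rule: infinite_finite_induct)
    (auto simp: Otilde_zero intro!: Otilde_add assms(1))

lemma Otilde_mult:
  assumes c: "0 \<le> c" "c \<le> 1" and "Otilde c f" "Otilde c g"
  shows "Otilde c (\<lambda>k. f k * g k)"
proof -
  obtain C M where C: "C \<ge> 0"
    and f: "eventually (\<lambda>k. \<bar>f k\<bar> \<le> C * (c ^ k * (1 + real k) ^ M)) sequentially"
    using assms by (auto simp: Otilde_iff)
  obtain D N where D: "D \<ge> 0"
    and g: "eventually (\<lambda>k. \<bar>g k\<bar> \<le> D * (c ^ k * (1 + real k) ^ N)) sequentially"
    using assms by (auto simp: Otilde_iff)
  have "eventually (\<lambda>k. \<bar>f k * g k\<bar> \<le> (C * D) * (c ^ k * (1 + real k) ^ (M + N))) sequentially"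
    using f g
  proof eventually_elim
    case (elim k)
    have "\<bar>f k * g k\<bar> \<le> (C * (c ^ k * (1 + real k) ^ M)) * (D * (c ^ k * (1 + real k) ^ N))"
      unfolding abs_mult using elim C c by (intro mult_mono) auto
    also have "\<dots> = (C * D * (c ^ k * (1 + real k) ^ (M + N))) * c ^ k"
      by (simp add: power_add mult_ac)
    also have "\<dots> \<le> (C * D * (c ^ k * (1 + real k) ^ (M + N))) * 1"
      using C D c by (intro mult_left_mono power_le_one) auto
    finally show ?case by simp
  qed
  then show ?thesis unfolding Otilde_iff[OF c(1)]
    using C D by (intro exI[of _ "C * D"] conjI exI[of _ "M + N"]) auto
qed

lemma Otilde_tendsto_0:
  assumes c: "0 \<le> c" "c < 1" and "Otilde c f"
  shows "f \<longlonglongrightarrow> 0"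
proof -
  obtain C N where
    f: "eventually (\<lambda>k. \<bar>f k\<bar> \<le> C * (c ^ k * (1 + real k) ^ N)) sequentially"
    using assms by (auto simp: Otilde_iff)
  have "(\<lambda>k. C * (c ^ k * (1 + real k) ^ N)) \<longlonglongrightarrow> 0"
  proof (cases "c = 0")
    case True
    then show ?thesis by (intro tendsto_eventually eventually_sequentiallyI[of 1]) auto
  next
    case False
    then have "(\<lambda>k. c ^ k * (1 + real k) ^ N) \<longlonglongrightarrow> 0" using c by real_asymp
    then show ?thesis by (intro tendsto_mult_right_zero)
  qed
  then have "(\<lambda>k. \<bar>f k\<bar>) \<longlonglongrightarrow> 0"
    by (rule tendsto_sandwich[where f = "\<lambda>k. 0", rotated 3]) (use f in auto)
  then show ?thesis by (rule tendsto_rabs_zero_cancel)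
qed

text \<open>Unrolling gives \<open>a k \<le> c ^ k * a 0 + (\<Sum>i<k. c ^ (k - 1 - i) * b i)\<close>.  Each of the \<open>k\<close> terms is
  of order \<open>c ^ (k - 1)\<close> times a polynomial, so the sum costs one more power of \<open>k\<close>.  This is where the polynomial factors of
  Jordan blocks come from.  For \<open>c = 0\<close> the bound says that a sequence vanishes eventually, and the
  recursion delays this by one step.\<close>

lemma Otilde_recurrence:
  fixes a b :: "nat \<Rightarrow> real"
  assumes c: "0 \<le> c" and a: "\<And>k. 0 \<le> a k" and rec: "\<And>k. a (Suc k) \<le> c * a k + b k"
    and b: "Otilde c b"
  shows "Otilde c a"
proof -
  obtain C N K where C: "C \<ge> 0"
    and bk: "\<And>k. k \<ge> K \<Longrightarrow> \<bar>b k\<bar> \<le> C * (c ^ k * (1 + real k) ^ N)"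
    using b c by (auto simp: Otilde_iff eventually_sequentially)
  show ?thesis
  proof (cases "c = 0")
    case True
    have "a k = 0" if k: "k \<ge> Suc (Suc K)" for k
    proof -
      obtain l where l: "k = Suc l" "l \<ge> Suc K" using k by (cases k) auto
      then have "b l = 0" using bk[of l] True by (simp add: power_0_left)
      then show ?thesis using rec[of l] a[of k] l True by simp
    qed
    then have "eventually (\<lambda>k. \<bar>a k\<bar> \<le> \<bar>0\<bar>) sequentially"
      by (intro eventually_sequentiallyI[of "Suc (Suc K)"]) auto
    then show ?thesis by (rule Otilde_mono[OF c Otilde_zero])
  next
    case False
    then have c0: "c > 0" using c by simp
    \<comment> \<open>The bound on \<open>b\<close> holds from \<open>K\<close> on only, so the unrolling starts at \<open>a K\<close>;
      dividing \<open>C\<close> by \<open>c\<close> accounts for \<open>b k\<close> entering \<open>a (Suc k)\<close>.\<close>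
    define M where "M = a K / c ^ K"
    define D where "D = C / c"
    have M: "M \<ge> 0" and D: "D \<ge> 0" using a c0 C by (auto simp: M_def D_def)
    have "a k \<le> c ^ k * (M + D * real k * (1 + real k) ^ N)" if "k \<ge> K" for k
      using that
    proof (induction k rule: dec_induct)
      case base
      have "c ^ K * (M + 0) \<le> c ^ K * (M + D * real K * (1 + real K) ^ N)"
        using c0 D by (intro mult_left_mono add_left_mono) auto
      then show ?case using c0 by (simp add: M_def)
    next
      case (step k)
      have "a (Suc k) \<le> c * (c ^ k * (M + D * real k * (1 + real k) ^ N))
          + C * (c ^ k * (1 + real k) ^ N)"
        using rec[of k] mult_left_mono[OF step.IH c] bk[of k] step.hyps by linarith
      also have "\<dots> = c ^ Suc k * (M + D * real (Suc k) * (1 + real k) ^ N)"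
        using c0 by (simp add: D_def field_simps)
      also have "\<dots> \<le> c ^ Suc k * (M + D * real (Suc k) * (1 + real (Suc k)) ^ N)"
        using c0 D by (intro mult_left_mono add_left_mono power_mono) auto
      finally show ?case .
    qed
    moreover have "c ^ k * (M + D * real k * (1 + real k) ^ N)
        \<le> (M + D) * (c ^ k * (1 + real k) ^ Suc N)" for k
    proof -
      have "M * 1 \<le> M * (1 + real k) ^ Suc N"
        using M by (intro mult_left_mono one_le_power) auto
      moreover have "D * (real k * (1 + real k) ^ N) \<le> D * (1 + real k) ^ Suc N"
        using D by (intro mult_left_mono) (auto intro!: mult_right_mono)
      ultimately have "M + D * real k * (1 + real k) ^ N \<le> (M + D) * (1 + real k) ^ Suc N"
        unfolding distrib_right mult.assoc by linarith
      then have "c ^ k * (M + D * real k * (1 + real k) ^ N)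
          \<le> c ^ k * ((M + D) * (1 + real k) ^ Suc N)"
        using c by (intro mult_left_mono) auto
      then show ?thesis by (simp only: mult.left_commute)
    qed
    ultimately have "\<bar>a k\<bar> \<le> (M + D) * (c ^ k * (1 + real k) ^ Suc N)" if "k \<ge> K" for k
      using that a[of k] order.trans by fastforce
    then show ?thesis unfolding Otilde_iff[OF c] eventually_sequentially
      using M D by (intro exI[of _ "M + D"] conjI exI[of _ "Suc N"] exI[of _ K]) auto
  qed
qed

text \<open>Row \<open>i\<close> involves only \<open>s\<^sub>i\<close>, with a coefficient of norm at most \<open>c\<close>, and the entries below it.  By
  induction from the last row these count as perturbations.\<close>

lemma Otilde_triangular_recurrence:
  fixes T :: "nat \<Rightarrow> nat \<Rightarrow> 'a :: real_normed_algebra" and s b :: "nat \<Rightarrow> nat \<Rightarrow> 'a"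
  assumes c: "0 \<le> c"
    and diag: "\<And>i. p \<le> i \<Longrightarrow> i < n \<Longrightarrow> norm (T i i) \<le> c"
    and rec: "\<And>k i. p \<le> i \<Longrightarrow> i < n \<Longrightarrow> s (Suc k) i = (\<Sum>j\<in>{i..<n}. T i j * s k j) + b k i"
    and b: "\<And>i. p \<le> i \<Longrightarrow> i < n \<Longrightarrow> Otilde c (\<lambda>k. norm (b k i))"
    and i: "p \<le> i" "i < n"
  shows "Otilde c (\<lambda>k. norm (s k i))"
  using i
proof (induction "n - i" arbitrary: i rule: less_induct)
  case less
  let ?f = "\<lambda>k. (\<Sum>j\<in>{Suc i..<n}. norm (T i j) * norm (s k j)) + norm (b k i)"
  have "norm (s (Suc k) i) \<le> c * norm (s k i) + ?f k" for k
  proof -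
    have "s (Suc k) i = T i i * s k i + ((\<Sum>j\<in>{Suc i..<n}. T i j * s k j) + b k i)"
      using less.prems by (simp add: rec sum.atLeast_Suc_lessThan)
    also have "norm \<dots> \<le> norm (T i i) * norm (s k i)
        + ((\<Sum>j\<in>{Suc i..<n}. norm (T i j) * norm (s k j)) + norm (b k i))"
      by (intro norm_triangle_le add_mono norm_mult_ineq sum_norm_le order_refl)
    also have "\<dots> \<le> c * norm (s k i) + ?f k"
      using diag less.prems by (intro add_right_mono mult_right_mono) auto
    finally show ?thesis .
  qed
  moreover have "Otilde c ?f"
    using less by (intro Otilde_add Otilde_sum Otilde_cmult b c) auto
  ultimately show ?case
    using Otilde_recurrence[OF c, of "\<lambda>k. norm (s k i)" ?f] by simp
qed


section \<open>Convergence at a rate\<close>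

definition converges_at_rate :: "real \<Rightarrow> (nat \<Rightarrow> 'a :: real_normed_vector) \<Rightarrow> 'a \<Rightarrow> bool" where
  "converges_at_rate c f l \<longleftrightarrow> Otilde c (\<lambda>k. norm (f k - l))"

lemma converges_at_rate_const: "converges_at_rate c (\<lambda>k. l) l"
  by (simp add: converges_at_rate_def Otilde_zero)

lemma converges_at_rate_contraction:
  assumes "0 \<le> c" "converges_at_rate c f l" "\<And>x y. norm (g x - g y) \<le> norm (x - y)"
  shows "converges_at_rate c (\<lambda>k. g (f k)) (g l)"
  unfolding converges_at_rate_def
  by (rule Otilde_mono[OF assms(1) assms(2)[unfolded converges_at_rate_def]])
    (simp add: assms(3))

lemma converges_at_rate_add:
  assumes "0 \<le> c" "converges_at_rate c f l" "converges_at_rate c g m"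
  shows "converges_at_rate c (\<lambda>k. f k + g k) (l + m)"
  unfolding converges_at_rate_def
proof (rule Otilde_mono[OF assms(1) Otilde_add[OF assms(1)]])
  show "eventually (\<lambda>k. \<bar>norm (f k + g k - (l + m))\<bar> \<le> \<bar>norm (f k - l) + norm (g k - m)\<bar>) sequentially"
    using norm_diff_triangle_ineq by (intro always_eventually) fastforce
qed (use assms in \<open>auto simp: converges_at_rate_def\<close>)

lemma converges_at_rate_mult:
  fixes f g :: "nat \<Rightarrow> 'a :: real_normed_algebra"
  assumes "0 \<le> c" "c \<le> 1" "converges_at_rate c f l" "converges_at_rate c g m"
  shows "converges_at_rate c (\<lambda>k. f k * g k) (l * m)"
  unfolding converges_at_rate_def
proof (rule Otilde_mono[OF assms(1)])
  let ?h = "\<lambda>k. norm (f k - l) * norm (g k - m) + (norm m * norm (f k - l) + norm l * norm (g k - m))"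
  show "Otilde c ?h"
    using assms by (intro Otilde_add Otilde_mult Otilde_cmult) (auto simp: converges_at_rate_def)
  have "norm (f k * g k - l * m) \<le> ?h k" for k
  proof -
    have "f k * g k - l * m = (f k - l) * (g k - m) + ((f k - l) * m + l * (g k - m))"
      by (simp add: algebra_simps)
    then show ?thesis
      by (metis norm_triangle_mono norm_mult_ineq mult.commute)
  qed
  then show "eventually (\<lambda>k. \<bar>norm (f k * g k - l * m)\<bar> \<le> \<bar>?h k\<bar>) sequentially"
    by (intro always_eventually allI) (simp add: abs_of_nonneg)
qed

text \<open>Since \<open>1 / p - 1 / q = (q\<^sup>2 - p\<^sup>2) / (p q (p + q))\<close>, the error is a bounded multiple of \<open>|a\<^sub>k - l|\<close> as
  soon as \<open>a\<^sub>k\<close> stays away from \<open>0\<close>; the assumption \<open>c < 1\<close> guarantees this.\<close>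

lemma converges_at_rate_inverse_sqrt:
  fixes a :: "nat \<Rightarrow> real"
  assumes c: "0 \<le> c" "c < 1" and l: "0 < l" and a: "converges_at_rate c a l"
  shows "converges_at_rate c (\<lambda>k. 1 / sqrt (a k)) (1 / sqrt l)"
  unfolding converges_at_rate_def
proof (rule Otilde_mono[OF c(1)])
  let ?C = "1 / (sqrt (l / 2) * sqrt l * sqrt l)"
  show "Otilde c (\<lambda>k. ?C * norm (a k - l))"
    using a unfolding converges_at_rate_def by (rule Otilde_cmult)
  have "(\<lambda>k. norm (a k - l)) \<longlonglongrightarrow> 0"
    using a c unfolding converges_at_rate_def by (intro Otilde_tendsto_0)
  then have "a \<longlonglongrightarrow> l"
    using LIM_zero_iff tendsto_norm_zero_iff by blast
  then have "eventually (\<lambda>k. a k > l / 2) sequentially"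
    using l by (intro order_tendstoD) auto
  then show "eventually (\<lambda>k. \<bar>norm (1 / sqrt (a k) - 1 / sqrt l)\<bar> \<le> \<bar>?C * norm (a k - l)\<bar>) sequentially"
  proof eventually_elim
    case (elim k)
    then have ak: "a k > 0" using l by simp
    define p q where "p = sqrt (a k)" and "q = sqrt l"
    have pq: "p > 0" "q > 0" "a k = p * p" "l = q * q" using ak l by (auto simp: p_def q_def)
    have "1 / p - 1 / q = (l - a k) / (p * q * (q + p))"
      using pq(1,2) by (simp add: pq(3,4) divide_simps) (simp add: algebra_simps)
    then have "\<bar>1 / p - 1 / q\<bar> = \<bar>a k - l\<bar> / (p * q * (q + p))"
      using pq(1,2) by (simp add: abs_minus_commute)
    then have "\<bar>1 / sqrt (a k) - 1 / sqrt l\<bar>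
        = \<bar>a k - l\<bar> / (sqrt (a k) * sqrt l * (sqrt l + sqrt (a k)))"
      by (simp add: p_def q_def)
    also have "\<dots> \<le> \<bar>a k - l\<bar> / (sqrt (l / 2) * sqrt l * sqrt l)"
      using ak l elim by (intro divide_left_mono mult_mono mult_pos_pos add_pos_pos) auto
    finally show ?case using l by (simp add: abs_mult)
  qed
qed


section \<open>Dual numbers\<close>

text \<open>Stated for the two parts separately, as then the product rule follows from the product formula
  for dual numbers; it is the bound \<open>Otilde_D\<close> for the difference
  (\<open>dual_converges_at_rate_iff_Otilde_D\<close>).\<close>

definition dual_converges_at_rate ::
  "real \<Rightarrow> (nat \<Rightarrow> 'a :: real_normed_algebra_1 dualnum) \<Rightarrow> 'a dualnum \<Rightarrow> bool" where
  "dual_converges_at_rate c f l \<longleftrightarrow>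
     converges_at_rate c (\<lambda>k. std_part (f k)) (std_part l) \<and>
     converges_at_rate c (\<lambda>k. dual_part (f k)) (dual_part l)"

lemma dual_converges_at_rate_iff_Otilde_D:
  "dual_converges_at_rate c f l \<longleftrightarrow> Otilde_D c (\<lambda>k. f k - l)"
  by (simp add: dual_converges_at_rate_def converges_at_rate_def Otilde_D_def)

lemma dual_converges_at_rate_const: "dual_converges_at_rate c (\<lambda>k. l) l"
  by (simp add: dual_converges_at_rate_def converges_at_rate_const)

lemma dual_converges_at_rate_add:
  assumes "0 \<le> c" "dual_converges_at_rate c f l" "dual_converges_at_rate c g m"
  shows "dual_converges_at_rate c (\<lambda>k. f k + g k) (l + m)"
  using assms unfolding dual_converges_at_rate_def by (auto intro!: converges_at_rate_add)

lemma dual_converges_at_rate_mult: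
  assumes "0 \<le> c" "c \<le> 1" "dual_converges_at_rate c f l" "dual_converges_at_rate c g m"
  shows "dual_converges_at_rate c (\<lambda>k. f k * g k) (l * m)"
  using assms unfolding dual_converges_at_rate_def
  by (auto intro!: converges_at_rate_add converges_at_rate_mult)

lemma dual_converges_at_rate_sum:
  assumes "0 \<le> c" "\<And>i. i \<in> I \<Longrightarrow> dual_converges_at_rate c (f i) (l i)"
  shows "dual_converges_at_rate c (\<lambda>k. \<Sum>i\<in>I. f i k) (\<Sum>i\<in>I. l i)"
  using assms(2) by (induction I rule: infinite_finite_induct)
    (auto intro: dual_converges_at_rate_const dual_converges_at_rate_add[OF assms(1)])


lemma std_part_sum: "std_part (\<Sum>i\<in>I. f i) = (\<Sum>i\<in>I. std_part (f i))"
  by (induction I rule: infinite_finite_induct) auto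

lemma dual_part_sum: "dual_part (\<Sum>i\<in>I. f i) = (\<Sum>i\<in>I. dual_part (f i))"
  by (induction I rule: infinite_finite_induct) auto

text \<open>The dual number \<open>a + b \<epsilon>\<close> with real \<open>a\<close> and \<open>b\<close>, available in every \<open>'a dualnum\<close> so that the same
  term can be used for quaternions and for complex numbers.\<close>

definition real_dual :: "real \<Rightarrow> real \<Rightarrow> 'a :: real_algebra_1 dualnum" where
  "real_dual a b = Dualnum (of_real a) (of_real b)"

lemma real_dual_sel [simp]:
  "std_part (real_dual a b) = of_real a" "dual_part (real_dual a b) = of_real b"
  by (simp_all add: real_dual_def)

lemma of_real_central: "of_real r * (x :: 'a :: real_algebra_1) = x * of_real r"
  by (simp add: of_real_def)

lemma real_dual_central: "real_dual a b * x = x * real_dual a b"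
  by (simp add: dualnum_eq_iff of_real_central add.commute)

lemma real_dual_mult: "real_dual a b * real_dual c d = real_dual (a * c) (a * d + b * c)"
  by (simp add: dualnum_eq_iff)

lemma inverse_real_dual:
  assumes "a \<noteq> 0"
  shows "inverse (real_dual a b :: 'a :: real_normed_div_algebra dualnum) = real_dual (1 / a) (- b / a\<^sup>2)"
proof -
  have "inverse (of_real a) * of_real b * inverse (of_real a) = (of_real (b / a\<^sup>2) :: 'a)"
    unfolding of_real_inverse[symmetric] of_real_mult[symmetric]
    by (simp only: divide_inverse power2_eq_square inverse_mult_distrib mult_ac)
  moreover have "inverse (of_real a) = (of_real (1 / a) :: 'a)"
    by (simp only: of_real_inverse inverse_eq_divide[symmetric])
  ultimately show ?thesis by (simp add: dualnum_eq_iff inverse_dualnum_def)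
qed

lemma real_dual_one: "real_dual 1 0 = 1"
  by (simp add: dualnum_eq_iff)

lemma Dual_Reals_cases:
  assumes "x \<in> Dual_Reals"
  obtains a b where "x = real_dual a b"
  using assms unfolding Dual_Reals_def by (auto elim!: Reals_cases simp: dualnum_eq_iff)

lemma quat_of_real_sel [simp]: "quat1 (of_real r) = of_real r" "quat2 (of_real r) = 0"
  by (simp_all add: of_real_def)

lemma quat_numeral_sel [simp]: "quat1 (numeral k) = numeral k" "quat2 (numeral k) = 0"
  using quat_of_real_sel[of "numeral k"] by simp_all

lemma quat1_sum: "quat1 (\<Sum>i\<in>I. f i) = (\<Sum>i\<in>I. quat1 (f i))"
  by (induction I rule: infinite_finite_induct) auto

lemma quat2_sum: "quat2 (\<Sum>i\<in>I. f i) = (\<Sum>i\<in>I. quat2 (f i))"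
  by (induction I rule: infinite_finite_induct) auto

lemma dual_abs_real_dual:
  assumes "a \<noteq> 0"
  shows "dual_abs (real_dual a b :: quat dualnum) = real_dual a b * real_dual (sgn a) 0"
proof -
  have "conjugate (of_real a) * of_real b + conjugate (of_real b) * of_real a = (of_real (2 * a * b) :: quat)"
    by (simp add: quat_eq_iff)
  then have "dual_abs (real_dual a b :: quat dualnum) = Dualnum (of_real \<bar>a\<bar>) (of_real (2 * a * b) /\<^sub>R (2 * \<bar>a\<bar>))"
    using assms by (simp add: dual_abs_def del: of_real_mult)
  also have "\<dots> = real_dual \<bar>a\<bar> (2 * a * b / (2 * \<bar>a\<bar>))"
    by (simp only: real_dual_def scaleR_conv_of_real divide_inverse mult.commute of_real_mult)
  also have "\<dots> = real_dual a b * real_dual (sgn a) 0"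
    unfolding real_dual_mult using assms by (auto simp: sgn_if)
  finally show ?thesis .
qed


lemma real_dual_power: "real_dual s 0 ^ k = real_dual (s ^ k) 0"
  by (induction k) (simp_all add: real_dual_one real_dual_mult)

lemma real_dual_over_dual_abs:
  assumes "a \<noteq> 0"
  shows "real_dual a b / dual_abs (real_dual a b :: quat dualnum) = real_dual (sgn a) 0"
proof -
  have "a * sgn a \<noteq> 0" using assms by (simp add: sgn_0_0)
  then show ?thesis using assms
    unfolding divide_dualnum_def dual_abs_real_dual[OF assms] real_dual_mult
    by (subst inverse_real_dual, simp, unfold real_dual_mult, intro arg_cong2[where f = real_dual])
      (auto simp: sgn_if power2_eq_square)
qed


section \<open>Norms and normalization\<close>

lemma appreciable_vec_iff: "appreciable_vec x \<longleftrightarrow> (\<exists>i<dim_vec x. std_part (x $ i) \<noteq> 0)"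
  unfolding appreciable_vec_def vec_eq_iff by auto

lemma norm2_eq_0_iff: "norm2 x = 0 \<longleftrightarrow> x = 0\<^sub>v (dim_vec x)"
  unfolding norm2_def vec_eq_iff by (auto simp: L2_set_eq_0_iff)

lemma norm2_nonneg: "norm2 x \<ge> 0"
  by (simp add: norm2_def L2_set_nonneg)

lemma norm2_power2: "(norm2 x)\<^sup>2 = (\<Sum>i<dim_vec x. (norm (x $ i))\<^sup>2)"
  by (simp add: norm2_def L2_set_def sum_nonneg)

lemma norm2_power2_quat: "scalar_prod (conjugate x) x = of_real ((norm2 (x :: quat vec))\<^sup>2)"
proof -
  have "conjugate p * p = of_real ((norm p)\<^sup>2)" for p :: quat
    by (simp add: quat_eq_iff quat_mult_conjugate del: quat_sel(11,12) of_real_power)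
  then show ?thesis
    by (simp add: norm2_power2 scalar_prod_def atLeast0LessThan del: of_real_power)
qed

lemma norm2_power2_complex: "scalar_prod (conjugate x) x = of_real ((norm2 (x :: complex vec))\<^sup>2)"
  by (simp add: norm2_power2 scalar_prod_def atLeast0LessThan complex_norm_square mult.commute
      del: of_real_power)

lemma std_part_scalar_prod:
  "dim_vec x = dim_vec y \<Longrightarrow>
   std_part (scalar_prod (conjugate x) y) = scalar_prod (conjugate (std_vec x)) (std_vec y)"
  by (simp add: scalar_prod_def std_part_sum conjugate_dualnum_def)

lemma dual_part_scalar_prod:
  fixes x y :: "'a :: {conjugate, ring_1} dualnum vec"
  assumes "dim_vec x = dim_vec y"
  shows "dual_part (scalar_prod (conjugate x) y)
    = scalar_prod (conjugate (std_vec x)) (dual_vec y) + scalar_prod (conjugate (dual_vec x)) (std_vec y)"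
  using assms by (simp add: scalar_prod_def dual_part_sum conjugate_dualnum_def sum.distrib)

lemma scalar_prod_symmetrized_real:
  fixes x y :: "quat vec"
  assumes "dim_vec x = dim_vec y"
  shows "scalar_prod (conjugate x) y + scalar_prod (conjugate y) x \<in> \<real>"
proof -
  have "conjugate p * q + conjugate q * p \<in> \<real>" for p q :: quat
  proof -
    have "conjugate p * q + conjugate q * p
        = of_real (2 * Re (cnj (quat1 p) * quat1 q + quat2 p * cnj (quat2 q)))"
      by (simp add: quat_eq_iff complex_eq_iff)
    then show ?thesis by (metis Reals_of_real)
  qed
  then have "(\<Sum>i\<in>{0..<dim_vec y}. conjugate (x $ i) * y $ i + conjugate (y $ i) * x $ i) \<in> \<real>"
    by (intro sum_in_Reals)
  then show ?thesis using assms by (simp add: scalar_prod_def sum.distrib)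
qed

text \<open>\<open>(a + b \<epsilon>)\<^sup>-\<^sup>1\<^sup>/\<^sup>2 = a\<^sup>-\<^sup>1\<^sup>/\<^sup>2 - (b / 2) a\<^sup>-\<^sup>3\<^sup>/\<^sup>2 \<epsilon>\<close>, applied to the real components of its argument.\<close>

definition inv_sqrt :: "quat dualnum \<Rightarrow> quat dualnum" where
  "inv_sqrt g = (let a = Re (quat1 (std_part g)); b = Re (quat1 (dual_part g)) in
     real_dual (1 / sqrt a) (- b / 2 * (1 / sqrt a) ^ 3))"

text \<open>Expressing \<open>1 / \<parallel>x\<parallel>\<close> through \<open>x\<^sup>* x\<close> avoids the case distinction in \<open>dual_norm2\<close> and leaves only
  algebraic operations and one square root.  It agrees with dividing by the norm when \<open>x\<close> is
  appreciable (\<open>normalize_dq_eq\<close>).\<close>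

definition normalize_dq :: "quat dualnum vec \<Rightarrow> quat dualnum vec" where
  "normalize_dq x = x \<cdot>\<^sub>r inv_sqrt (scalar_prod (conjugate x) x)"

text \<open>Stated for an abstract scalar type because it is applied to a quaternionic vector and to its
  complex image, which share \<open>a\<close> and \<open>b\<close>.\<close>

lemma inverse_dual_norm2:
  fixes x :: "'a :: {real_normed_div_algebra, conjugate} dualnum vec"
  assumes x: "appreciable_vec x" and a: "(norm2 (std_vec x))\<^sup>2 = a"
    and b: "scalar_prod (conjugate (std_vec x)) (dual_vec x)
      + scalar_prod (conjugate (dual_vec x)) (std_vec x) = of_real b"
  shows "inverse (dual_norm2 x) = real_dual (1 / sqrt a) (- b / 2 * (1 / sqrt a) ^ 3)"
proof -
  have n: "norm2 (std_vec x) = sqrt a" using a norm2_nonneg[of "std_vec x"] by (auto simp flip: a)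
  moreover have "norm2 (std_vec x) \<noteq> 0"
    using x by (simp add: norm2_eq_0_iff appreciable_vec_def)
  ultimately have a0: "sqrt a \<noteq> 0" by simp
  have "dual_norm2 x = real_dual (sqrt a) (b / (2 * sqrt a))"
    using x unfolding dual_norm2_def Let_def b n real_dual_def
    by (simp only: if_True divide_inverse scaleR_conv_of_real of_real_mult[symmetric] mult.commute[of b])
  then show ?thesis using a0
    by (simp add: inverse_real_dual power2_eq_square power3_eq_cube mult_ac del: real_sqrt_eq_zero_cancel_iff)
qed

lemma scalar_prod_conjugate_self_real_dual:
  fixes x :: "quat dualnum vec"
  obtains b where "scalar_prod (conjugate x) x = real_dual ((norm2 (std_vec x))\<^sup>2) b"
    "scalar_prod (conjugate (std_vec x)) (dual_vec x)
      + scalar_prod (conjugate (dual_vec x)) (std_vec x) = of_real b"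
proof -
  obtain b where b: "scalar_prod (conjugate (std_vec x)) (dual_vec x)
      + scalar_prod (conjugate (dual_vec x)) (std_vec x) = of_real b"
    using scalar_prod_symmetrized_real[of "std_vec x" "dual_vec x"] by (auto elim!: Reals_cases)
  have "scalar_prod (conjugate x) x = real_dual ((norm2 (std_vec x))\<^sup>2) b"
    using b by (simp add: dualnum_eq_iff std_part_scalar_prod dual_part_scalar_prod norm2_power2_quat
        del: of_real_power)
  with b show ?thesis using that by blast
qed

lemma normalize_dq_eq:
  assumes "appreciable_vec x"
  shows "normalize_dq x = x \<cdot>\<^sub>r inverse (dual_norm2 x)"
proof -
  obtain b where b: "scalar_prod (conjugate x) x = real_dual ((norm2 (std_vec x))\<^sup>2) b"
    "scalar_prod (conjugate (std_vec x)) (dual_vec x)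
      + scalar_prod (conjugate (dual_vec x)) (std_vec x) = of_real b"
    by (rule scalar_prod_conjugate_self_real_dual)
  have "inv_sqrt (scalar_prod (conjugate x) x)
      = real_dual (1 / sqrt ((norm2 (std_vec x))\<^sup>2)) (- b / 2 * (1 / sqrt ((norm2 (std_vec x))\<^sup>2)) ^ 3)"
    unfolding b(1) inv_sqrt_def Let_def real_dual_sel quat_of_real_sel Re_complex_of_real ..
  also have "\<dots> = inverse (dual_norm2 x)"
    by (rule inverse_dual_norm2[OF assms refl b(2), symmetric])
  finally show ?thesis by (simp add: normalize_dq_def)
qed

lemma vec_rscale_dim [simp]: "x \<cdot>\<^sub>r q \<in> carrier_vec n \<longleftrightarrow> x \<in> carrier_vec n"
  "dim_vec (x \<cdot>\<^sub>r q) = dim_vec x"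
  by (simp_all add: vec_rscale_def)

lemma vec_rscale_index [simp]: "i < dim_vec x \<Longrightarrow> (x \<cdot>\<^sub>r q) $ i = x $ i * q"
  by (simp add: vec_rscale_def)

lemma vec_rscale_rscale: "x \<cdot>\<^sub>r p \<cdot>\<^sub>r q = x \<cdot>\<^sub>r (p * q :: 'a :: semigroup_mult)"
  by (auto simp: vec_eq_iff mult.assoc)

lemma mult_mat_vec_rscale:
  fixes A :: "'a :: ring_1 mat"
  assumes "dim_vec x = dim_col A"
  shows "A *\<^sub>v (x \<cdot>\<^sub>r q) = (A *\<^sub>v x) \<cdot>\<^sub>r q"
  using assms by (auto simp: vec_eq_iff scalar_prod_def sum_distrib_right mult.assoc)

lemma normalize_dq_carrier [simp]: "normalize_dq x \<in> carrier_vec n \<longleftrightarrow> x \<in> carrier_vec n"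
  by (simp add: normalize_dq_def)

text \<open>The root of a square \<open>(s + t \<epsilon>)\<^sup>2\<close> is \<open>s + t \<epsilon>\<close> up to the sign of \<open>s\<close>.\<close>

lemma inv_sqrt_real_dual_mult:
  assumes s: "s \<noteq> 0" and a: "a > 0"
  shows "inv_sqrt (real_dual s t * real_dual s t * real_dual a b)
    = inverse (real_dual s t) * real_dual (sgn s) 0 * inv_sqrt (real_dual a b)"
proof -
  have r: "sqrt (s * s * a) = \<bar>s\<bar> * sqrt a" by (simp add: real_sqrt_mult)
  have q: "sqrt a * sqrt a = a" "sqrt a > 0" using a by simp_all
  have *: "1 / (\<bar>s\<bar> * sqrt a) = 1 / s * sgn s * (1 / sqrt a)" using s by (simp add: sgn_if)
  have "- (s * s * b + (s * t + t * s) * a) / 2 * (1 / (\<bar>s\<bar> * sqrt a)) ^ 3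
    = 1 / s * sgn s * (- b / 2 * (1 / sqrt a) ^ 3) + - t / s\<^sup>2 * sgn s * (1 / sqrt a)"
  proof -
    define p where "p = sqrt a"
    have "p > 0" and a: "a = p * p" using q by (simp_all add: p_def)
    then show ?thesis using s unfolding p_def[symmetric] a
      by (simp add: sgn_if power2_eq_square power3_eq_cube field_simps)
  qed
  then show ?thesis using s
    unfolding real_dual_mult inv_sqrt_def Let_def real_dual_sel quat_of_real_sel Re_complex_of_real
      inverse_real_dual[OF s] r by (intro arg_cong2[where f = real_dual]) (use * in auto)
qed

lemma scalar_prod_conjugate_rscale:
  fixes x :: "quat dualnum vec"
  assumes "dim_vec x = dim_vec y"
  shows "scalar_prod (conjugate (x \<cdot>\<^sub>r real_dual s t)) (y \<cdot>\<^sub>r real_dual s' t')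
    = real_dual s t * real_dual s' t' * scalar_prod (conjugate x) y"
proof -
  have "conjugate (p * real_dual s t) * (q * real_dual s' t')
      = real_dual s t * real_dual s' t' * (conjugate p * q)" for p q :: "quat dualnum"
  proof -
    have "conjugate (p * real_dual s t) = real_dual s t * conjugate p"
      by (simp add: dualnum_eq_iff conjugate_dualnum_def quat_eq_iff)
    then have "conjugate (p * real_dual s t) * (q * real_dual s' t')
        = real_dual s t * ((conjugate p * q) * real_dual s' t')"
      by (simp add: mult.assoc)
    also have "(conjugate p * q) * real_dual s' t' = real_dual s' t' * (conjugate p * q)"
      by (rule real_dual_central[symmetric])
    finally show ?thesis by (simp only: mult.assoc)
  qed
  then show ?thesis using assms by (simp add: scalar_prod_def sum_distrib_left)
qed

text \<open>Normalization forgets dual real scalars except for their sign.  This is what lets the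
  repeated normalization of the power method be postponed to the last step.\<close>

lemma normalize_dq_rscale:
  assumes x: "appreciable_vec x" and s: "s \<noteq> 0"
  shows "normalize_dq (x \<cdot>\<^sub>r real_dual s t) = normalize_dq x \<cdot>\<^sub>r real_dual (sgn s) 0"
proof -
  obtain b where b: "scalar_prod (conjugate x) x = real_dual ((norm2 (std_vec x))\<^sup>2) b"
    by (rule scalar_prod_conjugate_self_real_dual)
  have a: "(norm2 (std_vec x))\<^sup>2 > 0"
    using x by (simp add: norm2_eq_0_iff appreciable_vec_def)
  have "real_dual s t * inverse (real_dual s t) = (1 :: quat dualnum)"
    using s by (intro dualnum_inverse) auto
  then have "real_dual s t * (inverse (real_dual s t) * real_dual (sgn s) 0 * g)
      = g * (real_dual (sgn s) 0 :: quat dualnum)" for g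
    by (simp add: real_dual_central flip: mult.assoc)
  then show ?thesis
    unfolding normalize_dq_def
    by (simp add: scalar_prod_conjugate_rscale b inv_sqrt_real_dual_mult[OF s a] vec_rscale_rscale)
qed

lemma scalar_prod_normalize_dq:
  assumes x: "appreciable_vec x"
  shows "scalar_prod (conjugate (normalize_dq x)) (normalize_dq x) = 1"
proof -
  obtain b where b: "scalar_prod (conjugate x) x = real_dual ((norm2 (std_vec x))\<^sup>2) b"
    by (rule scalar_prod_conjugate_self_real_dual)
  define r where "r = norm2 (std_vec x)"
  have r: "r > 0"
    using x norm2_nonneg[of "std_vec x"] norm2_eq_0_iff[of "std_vec x"]
    by (auto simp add: appreciable_vec_def r_def order_less_le)
  have i: "inv_sqrt (real_dual (r\<^sup>2) b) = real_dual (1 / r) (- b / 2 * (1 / r) ^ 3)"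
    unfolding inv_sqrt_def Let_def real_dual_sel quat_of_real_sel Re_complex_of_real
    using r by simp
  have "scalar_prod (conjugate (normalize_dq x)) (normalize_dq x)
      = real_dual (1 / r) (- b / 2 * (1 / r) ^ 3) * real_dual (1 / r) (- b / 2 * (1 / r) ^ 3) * real_dual (r\<^sup>2) b"
    unfolding normalize_dq_def b r_def[symmetric] i scalar_prod_conjugate_rscale[OF refl] ..
  also have "\<dots> = 1" using r
    unfolding real_dual_mult real_dual_one[symmetric]
    by (intro arg_cong2[where f = real_dual]) (auto simp: power2_eq_square power3_eq_cube field_simps)
  finally show ?thesis .
qed

lemma inv_sqrt_converges_at_rate:
  assumes c: "0 \<le> c" "c < 1" and a: "a > 0"
    and f: "dual_converges_at_rate c f (real_dual a b)"
  shows "dual_converges_at_rate c (\<lambda>k. inv_sqrt (f k)) (inv_sqrt (real_dual a b))"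
proof -
  have contr: "norm (Re (quat1 p) - Re (quat1 q)) \<le> norm (p - q)" for p q
  proof -
    have "\<bar>Re (quat1 p) - Re (quat1 q)\<bar> \<le> cmod (quat1 (p - q))"
      using abs_Re_le_cmod[of "quat1 (p - q)"] by simp
    also have "\<dots> \<le> norm (p - q)"
      unfolding norm_quat_def by (simp add: real_le_rsqrt)
    finally show ?thesis by simp
  qed
  have s: "converges_at_rate c (\<lambda>k. Re (quat1 (std_part (f k)))) a"
    and d: "converges_at_rate c (\<lambda>k. Re (quat1 (dual_part (f k)))) b"
    using converges_at_rate_contraction[where g = "\<lambda>q. Re (quat1 q)", OF c(1) _ contr,
        OF f[unfolded dual_converges_at_rate_def, THEN conjunct1]]
      converges_at_rate_contraction[where g = "\<lambda>q. Re (quat1 q)", OF c(1) _ contr,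
        OF f[unfolded dual_converges_at_rate_def, THEN conjunct2]]
    by simp_all
  note inv = converges_at_rate_inverse_sqrt[OF c a s]
  have "converges_at_rate c (\<lambda>k. - 1 / 2 * Re (quat1 (dual_part (f k)))
        * (1 / sqrt (Re (quat1 (std_part (f k)))) * (1 / sqrt (Re (quat1 (std_part (f k))))
          * (1 / sqrt (Re (quat1 (std_part (f k))))))))
      (- 1 / 2 * b * (1 / sqrt a * (1 / sqrt a * (1 / sqrt a))))"
    using c by (intro converges_at_rate_mult inv d converges_at_rate_const) auto
  then have inv3: "converges_at_rate c (\<lambda>k. - Re (quat1 (dual_part (f k))) / 2
        * (1 / sqrt (Re (quat1 (std_part (f k))))) ^ 3) (- b / 2 * (1 / sqrt a) ^ 3)"
    by (simp only: power3_eq_cube mult.assoc minus_divide_left times_divide_eq_left mult_1_left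
        mult_minus_left)
  have of_real: "norm (of_real x - of_real y :: quat) \<le> norm (x - y)" for x y :: real
    by (simp flip: of_real_diff)
  show ?thesis
    unfolding dual_converges_at_rate_def inv_sqrt_def Let_def real_dual_sel quat_of_real_sel
      Re_complex_of_real
    by (intro conjI converges_at_rate_contraction[where g = of_real, OF c(1) _ of_real] inv inv3)
qed

lemma conjugate_converges_at_rate:
  fixes f :: "nat \<Rightarrow> quat dualnum"
  assumes "0 \<le> c" "dual_converges_at_rate c f l"
  shows "dual_converges_at_rate c (\<lambda>k. conjugate (f k)) (conjugate l)"
proof -
  have "norm (conjugate p - conjugate q) \<le> norm (p - q)" for p q :: quat
    unfolding norm_quat_def
    by (simp add: norm_minus_commute flip: complex_cnj_diff)
  then show ?thesis
    using assms unfolding dual_converges_at_rate_def conjugate_dualnum_def dualnum.sel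
    by (intro conjI converges_at_rate_contraction[where g = conjugate]) auto
qed

lemma scalar_prod_converges_at_rate:
  fixes x y :: "nat \<Rightarrow> quat dualnum vec"
  assumes c: "0 \<le> c" "c < 1"
    and dim: "\<And>k. x k \<in> carrier_vec n" "x' \<in> carrier_vec n" "\<And>k. y k \<in> carrier_vec n" "y' \<in> carrier_vec n"
    and x: "\<And>i. i < n \<Longrightarrow> dual_converges_at_rate c (\<lambda>k. x k $ i) (x' $ i)"
    and y: "\<And>i. i < n \<Longrightarrow> dual_converges_at_rate c (\<lambda>k. y k $ i) (y' $ i)"
  shows "dual_converges_at_rate c (\<lambda>k. scalar_prod (conjugate (x k)) (y k)) (scalar_prod (conjugate x') y')"
proof -
  have "dual_converges_at_rate c (\<lambda>k. conjugate (x k $ i) * y k $ i) (conjugate (x' $ i) * y' $ i)"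
    if "i < n" for i
    using c by (intro dual_converges_at_rate_mult conjugate_converges_at_rate x[OF that] y[OF that]) simp_all
  then have "dual_converges_at_rate c (\<lambda>k. \<Sum>i\<in>{0..<n}. conjugate (x k $ i) * y k $ i)
      (\<Sum>i\<in>{0..<n}. conjugate (x' $ i) * y' $ i)"
    by (intro dual_converges_at_rate_sum[OF c(1)]) simp
  moreover have "dim_vec (x k) = n" "dim_vec x' = n" "dim_vec (y k) = n" "dim_vec y' = n" for k
    using dim(1)[of k] dim(2) dim(3)[of k] dim(4) by auto
  ultimately show ?thesis by (simp add: scalar_prod_def)
qed

lemma normalize_dq_converges_at_rate:
  assumes c: "0 \<le> c" "c < 1"
    and dim: "\<And>k. x k \<in> carrier_vec n" "x' \<in> carrier_vec n"
    and x: "\<And>i. i < n \<Longrightarrow> dual_converges_at_rate c (\<lambda>k. x k $ i) (x' $ i)"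
    and x': "appreciable_vec x'" and i: "i < n"
  shows "dual_converges_at_rate c (\<lambda>k. normalize_dq (x k) $ i) (normalize_dq x' $ i)"
proof -
  obtain b where b: "scalar_prod (conjugate x') x' = real_dual ((norm2 (std_vec x'))\<^sup>2) b"
    by (rule scalar_prod_conjugate_self_real_dual)
  have a: "(norm2 (std_vec x'))\<^sup>2 > 0"
    using x' by (simp add: norm2_eq_0_iff appreciable_vec_def)
  have "dual_converges_at_rate c (\<lambda>k. scalar_prod (conjugate (x k)) (x k)) (scalar_prod (conjugate x') x')"
    by (intro scalar_prod_converges_at_rate[OF c dim dim] x)
  then have "dual_converges_at_rate c (\<lambda>k. inv_sqrt (scalar_prod (conjugate (x k)) (x k)))
      (inv_sqrt (scalar_prod (conjugate x') x'))"
    unfolding b by (intro inv_sqrt_converges_at_rate[OF c a])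
  with c x[OF i] have "dual_converges_at_rate c (\<lambda>k. x k $ i * inv_sqrt (scalar_prod (conjugate (x k)) (x k)))
      (x' $ i * inv_sqrt (scalar_prod (conjugate x') x'))"
    by (intro dual_converges_at_rate_mult) auto
  moreover have "dim_vec (x k) = n" "dim_vec x' = n" for k using dim(1)[of k] dim(2) by auto
  ultimately show ?thesis using i by (simp add: normalize_dq_def)
qed


lemma appreciable_rscale:
  assumes "appreciable_vec (x :: quat dualnum vec)" "s \<noteq> 0"
  shows "appreciable_vec (x \<cdot>\<^sub>r real_dual s t)"
  using assms by (auto simp: appreciable_vec_iff)

lemma scalar_prod_rscale_right:
  "dim_vec x = dim_vec y \<Longrightarrow> scalar_prod x (y \<cdot>\<^sub>r q) = scalar_prod x y * (q :: 'a :: ring_1)"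
  by (simp add: scalar_prod_def sum_distrib_right mult.assoc)

lemma mult_mat_vec_converges_at_rate:
  fixes A :: "quat dualnum mat"
  assumes c: "0 \<le> c" "c < 1" and A: "A \<in> carrier_mat m n"
    and x: "\<And>k. x k \<in> carrier_vec n" "x' \<in> carrier_vec n"
    and rate: "\<And>i. i < n \<Longrightarrow> dual_converges_at_rate c (\<lambda>k. x k $ i) (x' $ i)" and i: "i < m"
  shows "dual_converges_at_rate c (\<lambda>k. (A *\<^sub>v x k) $ i) ((A *\<^sub>v x') $ i)"
proof -
  have "dual_converges_at_rate c (\<lambda>k. A $$ (i, j) * x k $ j) (A $$ (i, j) * x' $ j)" if "j < n" for j
    using c by (intro dual_converges_at_rate_mult dual_converges_at_rate_const rate[OF that]) simp_all
  then have "dual_converges_at_rate c (\<lambda>k. \<Sum>j\<in>{0..<n}. A $$ (i, j) * x k $ j)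
      (\<Sum>j\<in>{0..<n}. A $$ (i, j) * x' $ j)"
    by (intro dual_converges_at_rate_sum[OF c(1)]) simp
  moreover have "dim_vec (x k) = n" "dim_vec x' = n" for k using x(1)[of k] x(2) by auto
  ultimately show ?thesis using A i by (simp add: scalar_prod_def)
qed


section \<open>The dual complex adjoint\<close>

lemma dual_vecI:
  assumes "dim_vec x = dim_vec y" "std_vec x = std_vec y" "dual_vec x = dual_vec y"
  shows "x = y"
  using assms by (auto simp: vec_eq_iff dualnum_eq_iff)

lemma std_vec_mult_mat_vec:
  "dim_vec x = dim_col A \<Longrightarrow> std_vec (A *\<^sub>v x) = std_mat A *\<^sub>v std_vec x"
  by (auto simp: vec_eq_iff scalar_prod_def std_part_sum)

lemma dual_vec_mult_mat_vec:
  fixes A :: "'a :: ring_1 dualnum mat"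
  shows "dim_vec x = dim_col A \<Longrightarrow> dual_vec (A *\<^sub>v x) = std_mat A *\<^sub>v dual_vec x + dual_mat A *\<^sub>v std_vec x"
  by (auto simp: vec_eq_iff scalar_prod_def dual_part_sum sum.distrib)

text \<open>Both components follow by comparing \<open>(A\<^sub>1 + A\<^sub>2 j) (x\<^sub>1 + x\<^sub>2 j)\<close>, where \<open>j z = cnj z j\<close>, with the
  block product; the second block row is the conjugate of the second component up to sign.\<close>

lemma quat_mat_adj_mult_vec:
  assumes "dim_vec x = dim_col A"
  shows "quat_mat_adj A *\<^sub>v quat_vec_adj x = quat_vec_adj (A *\<^sub>v x)"
proof -
  let ?a = "map_vec quat1 x" and ?b = "map_vec (\<lambda>q. - cnj (quat2 q)) x"
  have "quat_mat_adj A *\<^sub>v quat_vec_adj x =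
     (map_mat quat1 A *\<^sub>v ?a + map_mat quat2 A *\<^sub>v ?b) @\<^sub>v
     (map_mat (\<lambda>q. - cnj (quat2 q)) A *\<^sub>v ?a + map_mat (\<lambda>q. cnj (quat1 q)) A *\<^sub>v ?b)"
    unfolding quat_mat_adj_def quat_vec_adj_def
    using assms by (intro four_block_mat_mult_vec) (auto intro: carrier_vecI)
  also have "map_mat quat1 A *\<^sub>v ?a + map_mat quat2 A *\<^sub>v ?b = map_vec quat1 (A *\<^sub>v x)"
    using assms by (auto simp: vec_eq_iff scalar_prod_def quat1_sum sum_subtractf sum_negf)
  also have "map_mat (\<lambda>q. - cnj (quat2 q)) A *\<^sub>v ?a + map_mat (\<lambda>q. cnj (quat1 q)) A *\<^sub>v ?b
      = map_vec (\<lambda>q. - cnj (quat2 q)) (A *\<^sub>v x)"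
    using assms by (auto simp: vec_eq_iff scalar_prod_def quat2_sum sum_negf sum.distrib)
  finally show ?thesis by (simp add: quat_vec_adj_def)
qed

lemma dim_quat_vec_adj [simp]: "dim_vec (quat_vec_adj x) = 2 * dim_vec x"
  by (simp add: quat_vec_adj_def)

lemma dim_quat_mat_adj [simp]:
  "dim_row (quat_mat_adj A) = 2 * dim_row A" "dim_col (quat_mat_adj A) = 2 * dim_col A"
  by (simp_all add: quat_mat_adj_def)

lemma quat_vec_adj_index:
  "i < 2 * dim_vec x \<Longrightarrow> quat_vec_adj x $ i
    = (if i < dim_vec x then quat1 (x $ i) else - cnj (quat2 (x $ (i - dim_vec x))))"
  by (simp add: quat_vec_adj_def)

lemma quat_vec_adj_add:
  "dim_vec x = dim_vec y \<Longrightarrow> quat_vec_adj (x + y) = quat_vec_adj x + quat_vec_adj y"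
  by (rule eq_vecI) (simp_all add: quat_vec_adj_index)

lemma dq_vec_adj_sel [simp]:
  "std_vec (dq_vec_adj x) = quat_vec_adj (std_vec x)"
  "dual_vec (dq_vec_adj x) = quat_vec_adj (dual_vec x)"
  "dim_vec (dq_vec_adj x) = 2 * dim_vec x"
  by (auto simp: dq_vec_adj_def mk_dual_vec_def vec_eq_iff)

lemma dq_adjoint_sel [simp]:
  "std_mat (dq_adjoint A) = quat_mat_adj (std_mat A)"
  "dual_mat (dq_adjoint A) = quat_mat_adj (dual_mat A)"
  "dim_row (dq_adjoint A) = 2 * dim_row A" "dim_col (dq_adjoint A) = 2 * dim_col A"
  by (auto simp: dq_adjoint_def mk_dual_mat_def mat_eq_iff)

lemma dq_adjoint_mult_vec:
  assumes "dim_vec x = dim_col A"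
  shows "dq_adjoint A *\<^sub>v dq_vec_adj x = dq_vec_adj (A *\<^sub>v x)"
  using assms
  by (intro dual_vecI)
    (simp_all add: std_vec_mult_mat_vec dual_vec_mult_mat_vec quat_mat_adj_mult_vec quat_vec_adj_add)

lemma dq_vec_adj_index:
  "i < 2 * dim_vec x \<Longrightarrow> dq_vec_adj x $ i
    = (if i < dim_vec x then map_dualnum quat1 (x $ i)
       else map_dualnum (\<lambda>q. - cnj (quat2 q)) (x $ (i - dim_vec x)))"
  by (simp add: dq_vec_adj_def mk_dual_vec_def quat_vec_adj_index dualnum_eq_iff dualnum.map_sel)

lemma dq_vec_adj_rscale: "dq_vec_adj (x \<cdot>\<^sub>r real_dual a b) = dq_vec_adj x \<cdot>\<^sub>r real_dual a b"
  by (rule eq_vecI) (simp_all add: dq_vec_adj_index dualnum_eq_iff dualnum.map_sel)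

text \<open>The first component of \<open>x\<^sup>* y\<close> is \<open>\<Sum> cnj x\<^sub>1 y\<^sub>1 + x\<^sub>2 cnj y\<^sub>2\<close>, which is the complex inner product of the
  stacked vectors.  On the diagonal \<open>x\<^sup>* x\<close> is real, so norms are preserved as well.\<close>

lemma scalar_prod_quat_vec_adj:
  assumes "dim_vec x = dim_vec y"
  shows "scalar_prod (conjugate (quat_vec_adj x)) (quat_vec_adj y) = quat1 (scalar_prod (conjugate x) y)"
proof -
  have "conjugate (quat_vec_adj x)
      = map_vec (\<lambda>q. cnj (quat1 q)) x @\<^sub>v map_vec (\<lambda>q. - quat2 q) x"
    by (intro eq_vecI) (simp_all add: quat_vec_adj_def)
  then have "scalar_prod (conjugate (quat_vec_adj x)) (quat_vec_adj y)
      = scalar_prod (map_vec (\<lambda>q. cnj (quat1 q)) x) (map_vec quat1 y)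
      + scalar_prod (map_vec (\<lambda>q. - quat2 q) x) (map_vec (\<lambda>q. - cnj (quat2 q)) y)"
    unfolding quat_vec_adj_def
    using assms by (simp only:, intro scalar_prod_append) (auto intro: carrier_vecI)
  then show ?thesis
    using assms by (simp add: scalar_prod_def quat1_sum sum.distrib)
qed

lemma norm2_quat_vec_adj: "norm2 (quat_vec_adj x) = norm2 x"
proof -
  have "complex_of_real ((norm2 (quat_vec_adj x))\<^sup>2) = of_real ((norm2 x)\<^sup>2)"
    unfolding norm2_power2_complex[symmetric] scalar_prod_quat_vec_adj[OF refl]
    by (simp only: norm2_power2_quat quat_of_real_sel)
  then show ?thesis
    by (simp only: of_real_eq_iff) (metis norm2_nonneg power2_eq_iff_nonneg)
qed

lemma appreciable_dq_vec_adj: "appreciable_vec (dq_vec_adj x) \<longleftrightarrow> appreciable_vec x"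
  unfolding appreciable_vec_def
  using norm2_eq_0_iff[of "std_vec x"] norm2_eq_0_iff[of "quat_vec_adj (std_vec x)"]
  by (simp add: norm2_quat_vec_adj)

lemma normalize_dq_vec_adj:
  assumes "appreciable_vec x"
  shows "dq_vec_adj x \<cdot>\<^sub>r inverse (dual_norm2 (dq_vec_adj x)) = dq_vec_adj (normalize_dq x)"
proof -
  obtain b where b: "scalar_prod (conjugate (std_vec x)) (dual_vec x)
      + scalar_prod (conjugate (dual_vec x)) (std_vec x) = of_real b"
    by (rule scalar_prod_conjugate_self_real_dual)
  let ?a = "(norm2 (std_vec x))\<^sup>2"
  have "inverse (dual_norm2 (dq_vec_adj x)) = real_dual (1 / sqrt ?a) (- b / 2 * (1 / sqrt ?a) ^ 3)"
  proof (rule inverse_dual_norm2)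
    show "scalar_prod (conjugate (std_vec (dq_vec_adj x))) (dual_vec (dq_vec_adj x))
      + scalar_prod (conjugate (dual_vec (dq_vec_adj x))) (std_vec (dq_vec_adj x)) = of_real b"
      using b by (simp add: scalar_prod_quat_vec_adj flip: quat_sel(5))
  qed (use assms in \<open>simp_all add: appreciable_dq_vec_adj norm2_quat_vec_adj\<close>)
  moreover have "inverse (dual_norm2 x) = real_dual (1 / sqrt ?a) (- b / 2 * (1 / sqrt ?a) ^ 3)"
    by (rule inverse_dual_norm2[OF assms refl b])
  ultimately show ?thesis
    by (simp only: normalize_dq_eq[OF assms] dq_vec_adj_rscale)
qed

lemma DQ_of_DC_scalar_prod:
  assumes "dim_vec x = dim_vec y"
  shows "DQ_of_DC (scalar_prod (conjugate (dq_vec_adj x)) (dq_vec_adj y))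
    = map_dualnum (\<lambda>q. quat_of_complex (quat1 q)) (scalar_prod (conjugate x) y)"
  using assms
  by (simp add: DQ_of_DC_def dualnum_eq_iff dualnum.map_sel std_part_scalar_prod
      dual_part_scalar_prod scalar_prod_quat_vec_adj)

lemma complex_part_converges_at_rate:
  assumes "0 \<le> c" "dual_converges_at_rate c f l"
  shows "dual_converges_at_rate c (\<lambda>k. map_dualnum (\<lambda>q. quat_of_complex (quat1 q)) (f k))
    (map_dualnum (\<lambda>q. quat_of_complex (quat1 q)) l)"
proof -
  have "norm (quat_of_complex (quat1 p) - quat_of_complex (quat1 q)) \<le> norm (p - q)" for p q
    by (simp add: norm_quat_def quat_of_complex_def real_le_rsqrt)
  then show ?thesis
    using assms unfolding dual_converges_at_rate_def dualnum.map_sel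
    by (intro conjI converges_at_rate_contraction[where g = "\<lambda>q. quat_of_complex (quat1 q)"]) auto
qed


section \<open>Block upper triangular recursions\<close>

text \<open>All that the growth estimate uses of a Jordan matrix: in \<open>x \<mapsto> M x\<close> every coordinate is driven by
  itself, with a factor of norm at most \<open>c\<close>, and by later coordinates.\<close>

definition triangular_bounded :: "real \<Rightarrow> 'a :: real_normed_vector mat \<Rightarrow> bool" where
  "triangular_bounded c M \<longleftrightarrow> dim_row M = dim_col M \<and>
     (\<forall>i<dim_row M. \<forall>j<i. M $$ (i, j) = 0) \<and> (\<forall>i<dim_row M. norm (M $$ (i, i)) \<le> c)"

lemma triangular_bounded_diag_block_mat:
  "(\<And>M. M \<in> set Ms \<Longrightarrow> triangular_bounded c M) \<Longrightarrow> triangular_bounded c (diag_block_mat Ms)"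
proof (induction Ms)
  case Nil
  then show ?case by (simp add: triangular_bounded_def)
next
  case (Cons M Ms)
  then have "triangular_bounded c M" "triangular_bounded c (diag_block_mat Ms)" by auto
  then show ?case
    unfolding triangular_bounded_def by (auto simp: Let_def less_diff_conv2)
qed

lemma std_mat_diag_block_mat:
  "std_mat (diag_block_mat Ms) = diag_block_mat (map std_mat (Ms :: 'a :: ring_1 dualnum mat list))"
proof (induction Ms)
  case (Cons M Ms)
  have "dim_row (diag_block_mat (map std_mat Ms)) = dim_row (diag_block_mat Ms)"
    "dim_col (diag_block_mat (map std_mat Ms)) = dim_col (diag_block_mat Ms)"
    by (simp_all flip: Cons.IH)
  then show ?case
    by (auto simp: Let_def mat_eq_iff simp flip: Cons.IH)
qed auto

lemma norm_quat_of_complex [simp]: "norm (quat_of_complex z) = cmod z"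
  by (simp add: norm_quat_def quat_of_complex_def)

lemma triangular_bounded_jordan_part: "triangular_bounded (cmod l) (jordan_part l bs)"
  unfolding jordan_part_def jordan_matrix_def
  by (rule triangular_bounded_diag_block_mat)
    (auto simp: blocks_of_def triangular_bounded_def jordan_block_def)

lemma std_mat_mk_dual_mat [simp]: "std_mat (mk_dual_mat J H) = J"
  by (auto simp: mk_dual_mat_def mat_eq_iff)

lemma dim_mk_dual_mat [simp]:
  "dim_row (mk_dual_mat J H) = dim_row J" "dim_col (mk_dual_mat J H) = dim_col J"
  by (auto simp: mk_dual_mat_def)

text \<open>The standard parts satisfy the triangular recursion exactly.  The dual parts satisfy it with the
  perturbation \<open>H s\<close>, where \<open>H\<close> is the dual part of \<open>E\<close>.  As \<open>H\<close> need not be triangular, all standard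
  parts must be bounded before any dual part.\<close>

lemma dual_triangular_recurrence:
  fixes E :: "'a :: real_normed_algebra_1 dualnum mat" and z :: "nat \<Rightarrow> 'a dualnum vec"
  assumes c: "0 \<le> c" and E: "E \<in> carrier_mat n n" and z: "\<And>k. z k \<in> carrier_vec n"
    and rec: "\<And>k. z (Suc k) = E *\<^sub>v z k"
    and block: "\<And>i j. p \<le> i \<Longrightarrow> i < n \<Longrightarrow> j < p \<Longrightarrow> E $$ (i, j) = 0"
    and tri: "\<And>i j. p \<le> j \<Longrightarrow> j < i \<Longrightarrow> i < n \<Longrightarrow> std_part (E $$ (i, j)) = 0"
    and diag: "\<And>i. p \<le> i \<Longrightarrow> i < n \<Longrightarrow> norm (std_part (E $$ (i, i))) \<le> c"
    and i: "p \<le> i" "i < n"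
  shows "dual_converges_at_rate c (\<lambda>k. z k $ i) 0"
proof -
  let ?s = "\<lambda>k i. std_part (z k $ i)" and ?d = "\<lambda>k i. dual_part (z k $ i)"
  let ?T = "\<lambda>i j. std_part (E $$ (i, j))" and ?H = "\<lambda>i j. dual_part (E $$ (i, j))"
  have dim: "dim_vec (z k) = n" for k using z[of k] by simp
  have step: "z (Suc k) $ i = (\<Sum>j\<in>{p..<n}. E $$ (i, j) * z k $ j)" if "p \<le> i" "i < n" for k i
  proof -
    have "z (Suc k) $ i = (\<Sum>j\<in>{0..<n}. E $$ (i, j) * z k $ j)"
      using that E by (simp add: rec scalar_prod_def dim)
    also have "\<dots> = (\<Sum>j\<in>{p..<n}. E $$ (i, j) * z k $ j)"
      using that block by (intro sum.mono_neutral_right) auto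
    finally show ?thesis .
  qed
  have upper: "(\<Sum>j\<in>{p..<n}. ?T i j * f j) = (\<Sum>j\<in>{i..<n}. ?T i j * f j)"
    if "p \<le> i" "i < n" for i f
    using that tri by (intro sum.mono_neutral_right) auto
  have s: "Otilde c (\<lambda>k. norm (?s k i))" if "p \<le> i" "i < n" for i
  proof (rule Otilde_triangular_recurrence[OF c, of p n ?T ?s "\<lambda>_ _. 0"])
    show "?s (Suc k) i = (\<Sum>j\<in>{i..<n}. ?T i j * ?s k j) + 0" if "p \<le> i" "i < n" for k i
      unfolding step[OF that] by (simp add: std_part_sum upper[OF that])
  qed (use diag that in \<open>auto simp: Otilde_zero\<close>)
  have d: "Otilde c (\<lambda>k. norm (?d k i))"
  proof (rule Otilde_triangular_recurrence[OF c, of p n ?T ?d "\<lambda>k i. \<Sum>j\<in>{p..<n}. ?H i j * ?s k j"])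
    show "?d (Suc k) i = (\<Sum>j\<in>{i..<n}. ?T i j * ?d k j) + (\<Sum>j\<in>{p..<n}. ?H i j * ?s k j)"
      if "p \<le> i" "i < n" for k i
      unfolding step[OF that] by (simp add: dual_part_sum sum.distrib upper[OF that])
    show "Otilde c (\<lambda>k. norm (\<Sum>j\<in>{p..<n}. ?H i j * ?s k j))" if "p \<le> i" "i < n" for i
    proof (rule Otilde_mono[OF c])
      show "Otilde c (\<lambda>k. \<Sum>j\<in>{p..<n}. norm (?H i j) * norm (?s k j))"
        by (intro Otilde_sum[OF c] Otilde_cmult s) auto
      have "norm (\<Sum>j\<in>{p..<n}. ?H i j * ?s k j) \<le> (\<Sum>j\<in>{p..<n}. norm (?H i j) * norm (?s k j))" for k
        by (intro sum_norm_le norm_mult_ineq)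
      then show "eventually (\<lambda>k. \<bar>norm (\<Sum>j\<in>{p..<n}. ?H i j * ?s k j)\<bar>
          \<le> \<bar>\<Sum>j\<in>{p..<n}. norm (?H i j) * norm (?s k j)\<bar>) sequentially"
        by (intro always_eventually allI) (simp add: order.trans[OF _ abs_ge_self])
    qed
  qed (use diag i in auto)
  show ?thesis
    using s[OF i] d by (simp add: dual_converges_at_rate_def converges_at_rate_def)
qed


section \<open>Normalized iteration\<close>

text \<open>The initial vector of the power method is not normalized, so its index \<open>0\<close> has to be ignored.\<close>

lemma dual_converges_at_rate_cong:
  fixes f g :: "nat \<Rightarrow> 'a :: real_normed_algebra_1 dualnum"
  assumes "0 \<le> c" "dual_converges_at_rate c f l" "\<And>k. k \<ge> 1 \<Longrightarrow> g k = f k"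
  shows "dual_converges_at_rate c g l"
proof -
  have "Otilde c (\<lambda>k. norm (h (g k) - h l))" if "Otilde c (\<lambda>k. norm (h (f k) - h l))"
    for h :: "'a dualnum \<Rightarrow> 'a"
    by (rule Otilde_mono[OF assms(1) that], rule eventually_sequentiallyI[of 1]) (simp add: assms(3))
  then show ?thesis
    using assms(2) unfolding dual_converges_at_rate_def converges_at_rate_def by simp
qed

lemma Otilde_D_vecI:
  assumes c: "0 \<le> c" and e: "\<And>k. e k \<in> carrier_vec n"
    and comp: "\<And>i. i < n \<Longrightarrow> Otilde_D c (\<lambda>k. e k $ i)"
  shows "Otilde_D_vec c e"
proof -
  have dim: "dim_vec (e k) = n" for k using e[of k] by simp
  have "Otilde c (\<lambda>k. norm2 (map_vec g (e k)))"
    if "\<And>i. i < n \<Longrightarrow> Otilde c (\<lambda>k. norm (g (e k $ i)))" for g :: "'a dualnum \<Rightarrow> 'a"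
  proof (rule Otilde_mono[OF c])
    show "Otilde c (\<lambda>k. \<Sum>i<n. norm (g (e k $ i)))"
      by (intro Otilde_sum[OF c] that) auto
    have "norm2 (map_vec g (e k)) \<le> (\<Sum>i<n. norm (g (e k $ i)))" for k
      using L2_set_le_sum[of "{..<n}" "\<lambda>i. norm (map_vec g (e k) $ i)"]
      by (simp add: norm2_def dim)
    then show "eventually (\<lambda>k. \<bar>norm2 (map_vec g (e k))\<bar> \<le> \<bar>\<Sum>i<n. norm (g (e k $ i))\<bar>) sequentially"
      by (intro always_eventually allI) (simp add: norm2_nonneg order.trans[OF _ abs_ge_self])
  qed
  then show ?thesis
    using comp unfolding Otilde_D_vec_def Otilde_D_def by auto
qed

text \<open>By induction \<open>v\<^sub>k\<close> is \<open>X\<^sub>k\<close> times a dual real number whose standard part has the sign of \<open>a\<^sup>k\<close>.  Keeping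
  track of that sign is enough, as the next normalization discards the rest of the factor.\<close>

lemma normalized_iteration:
  fixes A :: "quat dualnum mat" and X v :: "nat \<Rightarrow> quat dualnum vec"
  assumes A: "A \<in> carrier_mat n n" and X: "\<And>k. X k \<in> carrier_vec n"
    and a: "a \<noteq> 0" and AX: "\<And>k. A *\<^sub>v X k = X (Suc k) \<cdot>\<^sub>r real_dual a b"
    and apprec: "\<And>k. appreciable_vec (X k)"
    and v0: "v 0 = X 0" and v: "\<And>k. v (Suc k) = normalize_dq (A *\<^sub>v v k)"
  shows "\<exists>s t. v k = X k \<cdot>\<^sub>r real_dual s t \<and> sgn s = sgn a ^ k \<and>
    (k \<ge> 1 \<longrightarrow> v k = normalize_dq (X k) \<cdot>\<^sub>r real_dual (sgn a ^ k) 0)"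
proof (induction k)
  case 0
  have "X 0 = X 0 \<cdot>\<^sub>r real_dual 1 0" by (simp add: real_dual_one vec_eq_iff)
  then show ?case using v0 by (intro exI[of _ 1] exI[of _ 0]) auto
next
  case (Suc k)
  then obtain s t where vk: "v k = X k \<cdot>\<^sub>r real_dual s t" and s: "sgn s = sgn a ^ k" by blast
  have "sgn s \<noteq> 0" using s a by (simp add: sgn_0_0)
  then have s0: "s \<noteq> 0" by auto
  have "dim_vec (X k) = dim_col A" using X[of k] A by auto
  then have "A *\<^sub>v v k = X (Suc k) \<cdot>\<^sub>r real_dual (a * s) (a * t + b * s)"
    by (simp add: vk mult_mat_vec_rscale AX vec_rscale_rscale real_dual_mult)
  then have "v (Suc k) = normalize_dq (X (Suc k)) \<cdot>\<^sub>r real_dual (sgn (a * s)) 0"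
    using a s0 by (simp add: v normalize_dq_rscale[OF apprec])
  then have v': "v (Suc k) = normalize_dq (X (Suc k)) \<cdot>\<^sub>r real_dual (sgn a ^ Suc k) 0"
    by (simp add: sgn_mult s)
  define g where "g = scalar_prod (conjugate (X (Suc k))) (X (Suc k))"
  obtain b' where g: "g = real_dual ((norm2 (std_vec (X (Suc k))))\<^sup>2) b'"
    unfolding g_def by (rule scalar_prod_conjugate_self_real_dual)
  define q where "q = norm2 (std_vec (X (Suc k)))"
  have q: "q > 0"
    using apprec[of "Suc k"] norm2_nonneg[of "std_vec (X (Suc k))"] norm2_eq_0_iff[of "std_vec (X (Suc k))"]
    by (auto simp add: appreciable_vec_def q_def order_less_le)
  obtain t' where "inv_sqrt g = real_dual (1 / q) t'"
    unfolding g q_def[symmetric] inv_sqrt_def Let_def real_dual_sel quat_of_real_sel Re_complex_of_real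
    using q by simp
  then have "v (Suc k) = X (Suc k) \<cdot>\<^sub>r real_dual (1 / q * sgn a ^ Suc k) (t' * sgn a ^ Suc k)"
    unfolding v' normalize_dq_def g_def[symmetric] vec_rscale_rscale by (simp add: real_dual_mult)
  moreover have "sgn (1 / q * sgn a ^ Suc k) = sgn a ^ Suc k"
  proof -
    have "sgn a ^ Suc k = 1 \<or> sgn a ^ Suc k = - 1"
      using a by (auto simp: sgn_if minus_one_power_iff)
    then show ?thesis using q by (elim disjE) simp_all
  qed
  ultimately show ?case using v' by blast
qed


lemma normalized_iteration_appreciable:
  fixes A :: "quat dualnum mat" and X v :: "nat \<Rightarrow> quat dualnum vec"
  assumes A: "A \<in> carrier_mat n n" and X: "\<And>k. X k \<in> carrier_vec n"
    and a: "a \<noteq> 0" and AX: "\<And>k. A *\<^sub>v X k = X (Suc k) \<cdot>\<^sub>r real_dual a b"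
    and apprec: "\<And>k. appreciable_vec (X k)"
    and v0: "v 0 = X 0" and v: "\<And>k. v (Suc k) = normalize_dq (A *\<^sub>v v k)"
  shows "appreciable_vec (A *\<^sub>v v k)"
proof -
  obtain s t where vk: "v k = X k \<cdot>\<^sub>r real_dual s t" and s: "sgn s = sgn a ^ k"
    using normalized_iteration[OF assms] by blast
  have "s \<noteq> 0" using s a by (auto simp: sgn_0_0)
  moreover have "A *\<^sub>v v k = X (Suc k) \<cdot>\<^sub>r real_dual (a * s) (a * t + b * s)"
    using X[of k] A by (simp add: vk mult_mat_vec_rscale AX vec_rscale_rscale real_dual_mult)
  ultimately show ?thesis using a by (simp add: appreciable_rscale apprec)
qed

text \<open>The deviation of the eigenvalue estimate has the same rate as that of the vectors, because the
  limit \<open>u\<close> of the normalized \<open>X\<^sub>k\<close> is a unit eigenvector: \<open>u\<^sup>* A u = u\<^sup>* u \<lambda>\<^sub>1 = \<lambda>\<^sub>1\<close>.\<close>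

lemma normalized_iteration_limit:
  fixes A :: "quat dualnum mat" and X v :: "nat \<Rightarrow> quat dualnum vec"
  assumes A: "A \<in> carrier_mat n n" and X: "\<And>k. X k \<in> carrier_vec n"
    and a: "a \<noteq> 0" and AX: "\<And>k. A *\<^sub>v X k = X (Suc k) \<cdot>\<^sub>r real_dual a b"
    and apprec: "\<And>k. appreciable_vec (X k)"
    and v0: "v 0 = X 0" and v: "\<And>k. v (Suc k) = normalize_dq (A *\<^sub>v v k)"
    and c: "0 \<le> c" "c < 1" and x': "x' \<in> carrier_vec n" "appreciable_vec x'"
    and Ax': "A *\<^sub>v x' = x' \<cdot>\<^sub>r real_dual a b"
    and rate: "\<And>i. i < n \<Longrightarrow> dual_converges_at_rate c (\<lambda>k. X k $ i) (x' $ i)"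
  shows "Otilde_D_vec c (\<lambda>k. v k - normalize_dq x' \<cdot>\<^sub>r real_dual (sgn a ^ k) 0)"
    and "dual_converges_at_rate c (\<lambda>k. scalar_prod (conjugate (v k)) (A *\<^sub>v v k)) (real_dual a b)"
proof -
  let ?N = "\<lambda>k. normalize_dq (X k)" and ?N' = "normalize_dq x'"
  have vk: "v k = ?N k \<cdot>\<^sub>r real_dual (sgn a ^ k) 0" if "k \<ge> 1" for k
    using normalized_iteration[OF A X a AX apprec v0 v, of k] that by blast
  have v_carrier: "v k \<in> carrier_vec n" for k
    using vk[of k] X v0 by (cases k) auto
  have N: "?N k \<in> carrier_vec n" "?N' \<in> carrier_vec n" for k using X x' by simp_all
  have dim: "dim_vec (v k) = n" "dim_vec (?N k) = n" "dim_vec ?N' = n" for k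
    using v_carrier[of k] N(1)[of k] N(2) by simp_all
  have rate_N: "dual_converges_at_rate c (\<lambda>k. ?N k $ i) (?N' $ i)" if "i < n" for i
    by (rule normalize_dq_converges_at_rate[OF c X x'(1) rate x'(2) that])
  have sgn_pow: "sgn a ^ k = 1 \<or> sgn a ^ k = - 1" for k
    using a by (auto simp: sgn_if minus_one_power_iff)
  show "Otilde_D_vec c (\<lambda>k. v k - ?N' \<cdot>\<^sub>r real_dual (sgn a ^ k) 0)"
  proof (rule Otilde_D_vecI[OF c(1), where n = n])
    show "v k - ?N' \<cdot>\<^sub>r real_dual (sgn a ^ k) 0 \<in> carrier_vec n" for k
      using v_carrier N by simp
    fix i assume i: "i < n"
    \<comment> \<open>Multiplication by the sign is an isometry on standard and dual parts; \<open>h\<close> stands for either.\<close>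
    have flip: "norm (h ((v k - ?N' \<cdot>\<^sub>r real_dual (sgn a ^ k) 0) $ i)) = norm (h (?N k $ i - ?N' $ i))"
      if k: "k \<ge> 1" and h: "\<And>q. h (q * real_dual (sgn a ^ k) 0) = h q * of_real (sgn a ^ k)"
      for k and h :: "quat dualnum \<Rightarrow> quat"
    proof -
      have eq: "(v k - ?N' \<cdot>\<^sub>r real_dual (sgn a ^ k) 0) $ i = (?N k $ i - ?N' $ i) * real_dual (sgn a ^ k) 0"
        using i k by (simp add: vk dim left_diff_distrib)
      show ?thesis
        unfolding eq h norm_mult norm_of_real using sgn_pow[of k] by auto
    qed
    have "Otilde c (\<lambda>k. norm (h ((v k - ?N' \<cdot>\<^sub>r real_dual (sgn a ^ k) 0) $ i)))"
      if "Otilde c (\<lambda>k. norm (h (?N k $ i - ?N' $ i)))"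
        and h: "\<And>q k. h (q * real_dual (sgn a ^ k) 0) = h q * of_real (sgn a ^ k)"
      for h :: "quat dualnum \<Rightarrow> quat"
      by (rule Otilde_mono[OF c(1) that(1)], rule eventually_sequentiallyI[of 1])
        (simp only: flip[where h = h, OF _ h] order_refl)
    from this[of std_part] this[of dual_part] rate_N[OF i]
    show "Otilde_D c (\<lambda>k. (v k - ?N' \<cdot>\<^sub>r real_dual (sgn a ^ k) 0) $ i)"
      by (simp add: dual_converges_at_rate_iff_Otilde_D Otilde_D_def)
  qed
  let ?S = "\<lambda>k. scalar_prod (conjugate (?N k)) (A *\<^sub>v ?N k)"
  have "A *\<^sub>v ?N' = ?N' \<cdot>\<^sub>r real_dual a b"
    using x'(1) A by (simp add: normalize_dq_def mult_mat_vec_rscale Ax' vec_rscale_rscale real_dual_central)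
  then have "scalar_prod (conjugate ?N') (A *\<^sub>v ?N') = real_dual a b"
    by (simp add: scalar_prod_rscale_right scalar_prod_normalize_dq[OF x'(2)])
  moreover have "dual_converges_at_rate c ?S (scalar_prod (conjugate ?N') (A *\<^sub>v ?N'))"
    using A N by (intro scalar_prod_converges_at_rate[OF c, of _ n] rate_N
        mult_mat_vec_converges_at_rate[OF c A]) auto
  ultimately have "dual_converges_at_rate c ?S (real_dual a b)" by simp
  moreover have "scalar_prod (conjugate (v k)) (A *\<^sub>v v k) = ?S k" if "k \<ge> 1" for k
  proof -
    have "sgn a ^ k * sgn a ^ k = 1" using sgn_pow[of k] by auto
    then show ?thesis
      using A by (simp add: vk[OF that] mult_mat_vec_rscale dim scalar_prod_conjugate_rscale
          real_dual_mult real_dual_one)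
  qed
  ultimately show "dual_converges_at_rate c (\<lambda>k. scalar_prod (conjugate (v k)) (A *\<^sub>v v k)) (real_dual a b)"
    by (rule dual_converges_at_rate_cong[OF c(1)])
qed

text \<open>\<open>u\<close> is the power method carried out on quaternionic vectors.  It is introduced separately from
  \<open>v\<close> because the complex normalization step corresponds to the quaternionic one only for appreciable
  vectors, and this has to be known for all \<open>k\<close> beforehand.\<close>

lemma adjoint_power_method:
  fixes A :: "quat dualnum mat" and w y :: "nat \<Rightarrow> complex dualnum vec"
    and u v :: "nat \<Rightarrow> quat dualnum vec"
  assumes A: "A \<in> carrier_mat n n" and v0: "v 0 \<in> carrier_vec n"
    and apprec: "\<And>k. appreciable_vec (A *\<^sub>v u k)"
    and u0: "u 0 = v 0" and u: "\<And>k. u (Suc k) = normalize_dq (A *\<^sub>v u k)"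
    and w0: "w 0 = dq_vec_adj (v 0)"
    and y: "\<And>k. k \<ge> 1 \<Longrightarrow> y k = dq_adjoint A *\<^sub>v w (k - 1)"
    and w: "\<And>k. k \<ge> 1 \<Longrightarrow> w k = y k \<cdot>\<^sub>r inverse (dual_norm2 (y k))"
    and v: "\<And>k. k \<ge> 1 \<Longrightarrow> v k = dq_vec_adj_inv n (w k)"
  shows "w k = dq_vec_adj (u k) \<and> v k = u k \<and> y (Suc k) = dq_vec_adj (A *\<^sub>v u k) \<and> u k \<in> carrier_vec n"
proof -
  have step: "y (Suc k) = dq_vec_adj (A *\<^sub>v u k)" if "w k = dq_vec_adj (u k)" "u k \<in> carrier_vec n" for k
    using y[of "Suc k"] that A by (simp add: dq_adjoint_mult_vec)
  have inv: "dq_vec_adj_inv n (dq_vec_adj x) = x" if "x \<in> carrier_vec n" for x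
    unfolding dq_vec_adj_inv_def
    using bij_betw_dq_vec_adj[of n] that by (intro inv_into_f_f) (auto simp: bij_betw_def)
  have "w k = dq_vec_adj (u k) \<and> v k = u k \<and> u k \<in> carrier_vec n"
  proof (induction k)
    case 0
    then show ?case using u0 w0 v0 by simp
  next
    case (Suc k)
    then have wk: "w k = dq_vec_adj (u k)" and uk: "u k \<in> carrier_vec n" by blast+
    have "u (Suc k) \<in> carrier_vec n" using A uk by (simp add: u)
    moreover have "w (Suc k) = dq_vec_adj (u (Suc k))"
      using w[of "Suc k"] by (simp add: step[OF wk uk] normalize_dq_vec_adj[OF apprec] u)
    ultimately show ?case using v[of "Suc k"] by (simp add: inv)
  qed
  with step[of k] show ?thesis by blast
qed


section \<open>Block partitions and the dominant eigenspace\<close>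

lemma sum_lessThan_add: "(\<Sum>i<N + q. f i) = (\<Sum>i<N. f i) + (\<Sum>c<q. f (N + c :: nat) :: 'a :: comm_monoid_add)"
  by (induction q) (simp_all add: add.assoc)

lemma block_sum:
  fixes f :: "nat \<Rightarrow> 'a :: comm_monoid_add" and m :: nat
  shows "(\<Sum>j\<in>{1..m}. \<Sum>c<nn j. f ((\<Sum>l\<in>{1..<j}. nn l) + c)) = (\<Sum>i<(\<Sum>j\<in>{1..m}. nn j). f i)"
  by (induction m) (simp_all add: sum_lessThan_add atLeastLessThanSuc_atLeastAtMost)

text \<open>The witness extends one for the first \<open>m\<close> blocks by a further block, which avoids computing the block
  that an index lies in.\<close>

lemma block_concat_exists:
  "\<exists>z. \<forall>j\<in>{1..m :: nat}. \<forall>c<nn j. z ((\<Sum>l\<in>{1..<j}. nn l) + c :: nat) = g j c"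
proof (induction m)
  case (Suc m)
  then obtain z where z: "\<forall>j\<in>{1..m}. \<forall>c<nn j. z ((\<Sum>l\<in>{1..<j}. nn l) + c) = g j c" by blast
  let ?N = "\<Sum>l\<in>{1..<Suc m}. nn l"
  let ?z = "\<lambda>i. if i < ?N then z i else g (Suc m) (i - ?N)"
  have "?z ((\<Sum>l\<in>{1..<j}. nn l) + c) = g j c" if "j \<in> {1..Suc m}" "c < nn j" for j c
  proof (cases "j = Suc m")
    case False
    then have j: "j \<in> {1..m}" using that by auto
    have "(\<Sum>l\<in>{1..<j}. nn l) + nn j = (\<Sum>l\<in>{1..<Suc j}. nn l)" using j by simp
    also have "\<dots> \<le> ?N" using j by (intro sum_mono2) auto
    finally have "(\<Sum>l\<in>{1..<j}. nn l) + c < ?N" using that(2) by linarith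
    then show ?thesis using z[rule_format, OF j that(2)] by (simp only: if_True)
  next
    case True
    then show ?thesis by simp
  qed
  then show ?case by (intro exI[of _ ?z]) blast
qed simp


text \<open>A vector with vanishing standard part is mapped to such a vector by every dual matrix, in
  particular by the left inverse \<open>Q\<close> of \<open>P\<close>.\<close>

lemma appreciable_mult_invertible:
  fixes P Q :: "quat dualnum mat"
  assumes P: "P \<in> carrier_mat n n" and Q: "Q \<in> carrier_mat n n" "inverts_mat Q P"
    and z: "z \<in> carrier_vec n" "i < n" "std_part (z $ i) \<noteq> 0"
  shows "appreciable_vec (P *\<^sub>v z)"
proof (rule ccontr)
  assume "\<not> appreciable_vec (P *\<^sub>v z)"
  then have 0: "std_part ((P *\<^sub>v z) $ j) = 0" if "j < n" for j
    using that P by (auto simp: appreciable_vec_iff simp del: index_mult_mat_vec)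
  have "Q *\<^sub>v (P *\<^sub>v z) = z"
    using assoc_mult_mat_vec[OF Q(1) P z(1)] Q z(1) by (simp add: inverts_mat_def)
  moreover have "std_part ((Q *\<^sub>v (P *\<^sub>v z)) $ i) = 0"
    using z(2) Q(1) P 0 by (simp add: scalar_prod_def[of "row Q i"] std_part_sum del: assoc_mult_mat_vec)
  ultimately show False using z(3) by simp
qed

text \<open>\<open>X\<^sub>k = P (D \<lambda>\<^sub>1\<^sup>-\<^sup>1)\<^sup>k z\<close>, where \<open>\<lambda>\<^sub>1\<close> is \<open>real_dual a b\<close>, and \<open>\<eta>\<close> is \<open>z\<close> cut down to the dominant block.
  Centrality of \<open>\<lambda>\<^sub>1\<close> allows its inverse to be moved into the matrix; the triangular recursion then
  applies with diagonal bound \<open>r / |a|\<close>.\<close>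

lemma block_diagonal_power_iteration:
  fixes A P Q D :: "quat dualnum mat" and z \<eta> :: "quat dualnum vec" and r :: real
  assumes A: "A \<in> carrier_mat n n" and P: "P \<in> carrier_mat n n"
    and Q: "Q \<in> carrier_mat n n" "inverts_mat P Q" "inverts_mat Q P"
    and D: "Q * A * P = D"
    and a: "a \<noteq> 0" and r: "0 \<le> r" "r < \<bar>a\<bar>"
    and top: "\<And>i j. i < p \<Longrightarrow> j < n \<Longrightarrow> D $$ (i, j) = (if i = j then real_dual a b else 0)"
    and block: "\<And>i j. p \<le> i \<Longrightarrow> i < n \<Longrightarrow> j < p \<Longrightarrow> D $$ (i, j) = 0"
    and tri: "\<And>i j. p \<le> j \<Longrightarrow> j < i \<Longrightarrow> i < n \<Longrightarrow> std_part (D $$ (i, j)) = 0"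
    and diag: "\<And>i. p \<le> i \<Longrightarrow> i < n \<Longrightarrow> norm (std_part (D $$ (i, i))) \<le> r"
    and p: "p \<le> n" and z: "z \<in> carrier_vec n"
    and \<eta>: "\<eta> \<in> carrier_vec n" "\<And>i. i < p \<Longrightarrow> \<eta> $ i = z $ i"
      "\<And>i. p \<le> i \<Longrightarrow> i < n \<Longrightarrow> \<eta> $ i = 0"
    and nz: "i0 < p" "std_part (z $ i0) \<noteq> 0"
  obtains X where "X 0 = P *\<^sub>v z" "\<And>k. X k \<in> carrier_vec n"
    "\<And>k. A *\<^sub>v X k = X (Suc k) \<cdot>\<^sub>r real_dual a b" "\<And>k. appreciable_vec (X k)"
    "A *\<^sub>v (P *\<^sub>v \<eta>) = (P *\<^sub>v \<eta>) \<cdot>\<^sub>r real_dual a b" "appreciable_vec (P *\<^sub>v \<eta>)"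
    "\<And>i. i < n \<Longrightarrow> dual_converges_at_rate (r / \<bar>a\<bar>) (\<lambda>k. X k $ i) ((P *\<^sub>v \<eta>) $ i)"
proof -
  define \<mu> :: "quat dualnum" where "\<mu> = real_dual (1 / a) (- b / a\<^sup>2)"
  have \<mu>: "\<mu> * real_dual a b = 1"
    using a by (simp add: \<mu>_def real_dual_mult power2_eq_square flip: real_dual_one)
  define E where "E = mat n n (\<lambda>ij. \<mu> * D $$ ij)"
  have D_carrier: "D \<in> carrier_mat n n" using A P Q by (auto simp flip: D)
  have E: "E \<in> carrier_mat n n" by (simp add: E_def)
  have D_eq: "D *\<^sub>v x = (E *\<^sub>v x) \<cdot>\<^sub>r real_dual a b" if x: "x \<in> carrier_vec n" for x
  proof (rule eq_vecI)
    fix i assume "i < dim_vec ((E *\<^sub>v x) \<cdot>\<^sub>r real_dual a b)"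
    then have i: "i < n" by (simp add: E_def)
    have "(E *\<^sub>v x) $ i * real_dual a b = (\<Sum>j\<in>{0..<n}. \<mu> * D $$ (i, j) * x $ j) * real_dual a b"
      using i x by (simp add: E_def scalar_prod_def)
    also have "\<dots> = (\<Sum>j\<in>{0..<n}. \<mu> * real_dual a b * (D $$ (i, j) * x $ j))"
      unfolding sum_distrib_right
    proof (rule sum.cong)
      fix j
      have "\<mu> * D $$ (i, j) * x $ j * real_dual a b = \<mu> * ((D $$ (i, j) * x $ j) * real_dual a b)"
        by (simp only: mult.assoc)
      also have "(D $$ (i, j) * x $ j) * real_dual a b = real_dual a b * (D $$ (i, j) * x $ j)"
        by (rule real_dual_central[symmetric])
      finally show "\<mu> * D $$ (i, j) * x $ j * real_dual a b = \<mu> * real_dual a b * (D $$ (i, j) * x $ j)"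
        by (simp only: mult.assoc)
    qed simp
    also have "\<dots> = (D *\<^sub>v x) $ i"
      using i x D_carrier by (simp add: \<mu> scalar_prod_def)
    finally show "(D *\<^sub>v x) $ i = ((E *\<^sub>v x) \<cdot>\<^sub>r real_dual a b) $ i"
      using i by (simp add: E_def)
  qed (use D_carrier in \<open>simp add: E_def\<close>)
  have AP: "A * P = P * D"
  proof -
    have "P * D = P * (Q * (A * P))" using A P Q(1) by (simp flip: D)
    also have "\<dots> = (P * Q) * (A * P)"
      using A P Q(1) by (intro assoc_mult_mat[symmetric]) auto
    also have "\<dots> = A * P"
      using A P Q(1,2) by (simp add: inverts_mat_def)
    finally show ?thesis ..
  qed
  have APx: "A *\<^sub>v (P *\<^sub>v x) = (P *\<^sub>v (E *\<^sub>v x)) \<cdot>\<^sub>r real_dual a b" if x: "x \<in> carrier_vec n" for x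
  proof -
    have "A *\<^sub>v (P *\<^sub>v x) = (A * P) *\<^sub>v x" using A P x by simp
    also have "\<dots> = P *\<^sub>v ((E *\<^sub>v x) \<cdot>\<^sub>r real_dual a b)"
      using P D_carrier x by (simp add: AP D_eq)
    also have "\<dots> = (P *\<^sub>v (E *\<^sub>v x)) \<cdot>\<^sub>r real_dual a b"
      using P E by (intro mult_mat_vec_rscale) simp
    finally show ?thesis .
  qed
  have E_top: "(E *\<^sub>v x) $ i = x $ i" if "i < p" and x: "x \<in> carrier_vec n" for x i
  proof -
    have "(E *\<^sub>v x) $ i = (\<Sum>j\<in>{0..<n}. if j = i then x $ i else 0)"
    proof -
      have "\<mu> * D $$ (i, j) * x $ j = (if j = i then x $ i else 0)" if "j < n" for j
        using \<open>i < p\<close> that by (simp add: top \<mu>)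
      then have "(\<Sum>j\<in>{0..<n}. \<mu> * D $$ (i, j) * x $ j) = (\<Sum>j\<in>{0..<n}. if j = i then x $ i else 0)"
        by (intro sum.cong) auto
      then show ?thesis using that p x by (simp add: E_def scalar_prod_def)
    qed
    then show ?thesis using that p by simp
  qed
  define \<zeta> where "\<zeta> k = ((\<lambda>x. E *\<^sub>v x) ^^ k) z" for k
  have \<zeta>_Suc: "\<zeta> (Suc k) = E *\<^sub>v \<zeta> k" for k by (simp add: \<zeta>_def)
  have \<zeta>: "\<zeta> k \<in> carrier_vec n" for k
    using E z by (induction k) (simp_all add: \<zeta>_Suc, simp add: \<zeta>_def)
  have \<zeta>_top: "\<zeta> k $ i = z $ i" if "i < p" for k i
    using that \<zeta> by (induction k) (simp_all add: \<zeta>_Suc E_top del: index_mult_mat_vec, simp add: \<zeta>_def)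
  have rate: "dual_converges_at_rate (r / \<bar>a\<bar>) (\<lambda>k. \<zeta> k $ i) (\<eta> $ i)" if i: "i < n" for i
  proof (cases "i < p")
    case True
    then show ?thesis by (simp add: \<zeta>_top \<eta> dual_converges_at_rate_const)
  next
    case False
    have "dual_converges_at_rate (r / \<bar>a\<bar>) (\<lambda>k. \<zeta> k $ i) 0"
    proof (rule dual_triangular_recurrence[where z = \<zeta>, OF _ E \<zeta> \<zeta>_Suc])
      show "norm (std_part (E $$ (i, i))) \<le> r / \<bar>a\<bar>" if "p \<le> i" "i < n" for i
        proof -
        have "norm (std_part (E $$ (i, i))) = norm (of_real (1 / a) :: quat) * norm (std_part (D $$ (i, i)))"
          using that by (simp add: E_def \<mu>_def norm_mult del: of_real_divide)
        also have "\<dots> = norm (std_part (D $$ (i, i))) / \<bar>a\<bar>"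
          unfolding norm_of_real by simp
        finally show ?thesis using diag[OF that] by (simp add: divide_right_mono)
      qed
    qed (use False i r block tri in \<open>auto simp: E_def\<close>)
    then show ?thesis using False i by (simp add: \<eta>)
  qed
  have E\<eta>: "E *\<^sub>v \<eta> = \<eta>"
  proof (rule eq_vecI)
    fix i assume "i < dim_vec \<eta>"
    then have i: "i < n" using \<eta>(1) by simp
    show "(E *\<^sub>v \<eta>) $ i = \<eta> $ i"
    proof (cases "i < p")
      case True
      then show ?thesis by (rule E_top[OF _ \<eta>(1)])
    next
      case False
      have "E $$ (i, j) * \<eta> $ j = 0" if "j < n" for j
        using False i that block[of i j] \<eta>(3)[of j] by (cases "j < p") (auto simp: E_def)
      then have "(E *\<^sub>v \<eta>) $ i = 0"
        using E \<eta>(1) i by (simp add: scalar_prod_def)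
      then show ?thesis using False i by (simp add: \<eta>(3))
    qed
  qed (use E \<eta>(1) in auto)
  show ?thesis
  proof (rule that[of "\<lambda>k. P *\<^sub>v \<zeta> k"])
    show "A *\<^sub>v (P *\<^sub>v \<zeta> k) = P *\<^sub>v \<zeta> (Suc k) \<cdot>\<^sub>r real_dual a b" for k
      by (simp add: APx[OF \<zeta>] \<zeta>_Suc)
    show "appreciable_vec (P *\<^sub>v \<zeta> k)" for k
      using nz p by (intro appreciable_mult_invertible[OF P Q(1,3) \<zeta>, of i0]) (auto simp: \<zeta>_top)
    show "appreciable_vec (P *\<^sub>v \<eta>)"
      using nz p by (intro appreciable_mult_invertible[OF P Q(1,3) \<eta>(1), of i0]) (auto simp: \<eta>)
    show "A *\<^sub>v (P *\<^sub>v \<eta>) = (P *\<^sub>v \<eta>) \<cdot>\<^sub>r real_dual a b"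
      by (simp add: APx[OF \<eta>(1)] E\<eta>)
    show "dual_converges_at_rate (r / \<bar>a\<bar>) (\<lambda>k. (P *\<^sub>v \<zeta> k) $ i) ((P *\<^sub>v \<eta>) $ i)" if "i < n" for i
      using a r by (intro mult_mat_vec_converges_at_rate[OF _ _ P \<zeta> \<eta>(1) rate that]) auto
  qed (use P \<zeta> in \<open>auto simp: \<zeta>_def\<close>)
qed

lemma block_diagonal_entries:
  fixes Ms :: "quat dualnum mat list"
  assumes D: "D = diag_block_mat ((l \<cdot>\<^sub>m 1\<^sub>m p) # Ms)" "D \<in> carrier_mat n n"
    and Ms: "\<And>M. M \<in> set Ms \<Longrightarrow> triangular_bounded r (std_mat M)"
  shows "p \<le> n"
    and "\<And>i j. i < p \<Longrightarrow> j < n \<Longrightarrow> D $$ (i, j) = (if i = j then l else 0)"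
    and "\<And>i j. p \<le> i \<Longrightarrow> i < n \<Longrightarrow> j < p \<Longrightarrow> D $$ (i, j) = 0"
    and "\<And>i j. p \<le> j \<Longrightarrow> j < i \<Longrightarrow> i < n \<Longrightarrow> std_part (D $$ (i, j)) = 0"
    and "\<And>i. p \<le> i \<Longrightarrow> i < n \<Longrightarrow> norm (std_part (D $$ (i, i))) \<le> r"
proof -
  let ?D = "diag_block_mat Ms"
  have "triangular_bounded r (std_mat ?D)"
    unfolding std_mat_diag_block_mat by (rule triangular_bounded_diag_block_mat) (use Ms in auto)
  then have sq: "dim_row ?D = dim_col ?D"
    and tri: "\<And>i j. i < dim_row ?D \<Longrightarrow> j < i \<Longrightarrow> std_part (?D $$ (i, j)) = 0"
    and diag: "\<And>i. i < dim_row ?D \<Longrightarrow> norm (std_part (?D $$ (i, i))) \<le> r"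
    unfolding triangular_bounded_def by auto
  have n: "n = p + dim_row ?D" using D by (auto simp: Let_def)
  have entry: "D $$ (i, j) = (if i < p then if j < p then (if i = j then l else 0) else 0
      else if j < p then 0 else ?D $$ (i - p, j - p))" if "i < n" "j < n" for i j
    using that sq by (simp add: D(1) Let_def n)
  show "p \<le> n" by (simp add: n)
  show "D $$ (i, j) = (if i = j then l else 0)" if "i < p" "j < n" for i j
    using that n by (simp add: entry)
  show "D $$ (i, j) = 0" if "p \<le> i" "i < n" "j < p" for i j
    using that n by (simp add: entry)
  show "std_part (D $$ (i, j)) = 0" if "p \<le> j" "j < i" "i < n" for i j
    using that n by (simp add: entry tri)
  show "norm (std_part (D $$ (i, i))) \<le> r" if "p \<le> i" "i < n" for i
    using that n by (simp add: entry diag)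
qed

theorem theorem3p14:
  fixes n m :: nat
    and A P Pinv :: "quat dualnum mat"
    and lam :: "nat \<Rightarrow> complex"
    and nn :: "nat \<Rightarrow> nat"
    and lam_hat :: "quat dualnum"
    and bs :: "(nat \<times> complex) list"
    and J H :: "nat \<Rightarrow> quat mat"
    and U :: "nat \<Rightarrow> quat dualnum mat"
    and eta :: "nat \<Rightarrow> quat dualnum vec"
    and v :: "nat \<Rightarrow> quat dualnum vec"
    and B :: "complex dualnum mat"
    and w y :: "nat \<Rightarrow> complex dualnum vec"
    and lamk :: "nat \<Rightarrow> complex dualnum"
  assumes A: "A \<in> carrier_mat n n"
    and m: "m \<ge> 2"
    \<comment> \<open>the distinct standard eigenvalues of the standard part and their multiplicities\<close>
    and lam_set: "lam ` {1..m} = standard_eigenvalues (std_mat A)"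
    and lam_distinct: "inj_on lam {1..m}"
    and nn: "\<And>i. i \<in> {1..m} \<Longrightarrow> nn i = quat_alg_mult (lam i) (std_mat A)"
    and lam_dominant: "cmod (lam 1) > cmod (lam 2)"
    and lam_order: "\<And>i. 2 \<le> i \<Longrightarrow> i < m \<Longrightarrow> cmod (lam i) \<ge> cmod (lam (i + 1))"
    and lam_1_real: "lam 1 \<in> \<real>"
    \<comment> \<open>the dominant eigenvalue\<close>
    and lam1_real: "lam_hat \<in> Dual_Reals"
    and lam1_std: "std_part lam_hat = quat_of_complex (lam 1)"
    and lam1_eigenvalue: "dq_eigenvalue A lam_hat"
    and lam1_mult: "dq_mult lam_hat A = quat_alg_mult (lam 1) (std_mat A)"
    \<comment> \<open>the Jordan blocks of the standard part and the block diagonalization\<close>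
    and bs: "quat_jordan_form (std_mat A) bs"
    and J: "\<And>i. i \<in> {1..m} \<Longrightarrow> J i \<in> carrier_mat (nn i) (nn i) \<and> J i = jordan_part (lam i) bs"
    and H: "\<And>i. i \<in> {2..m} \<Longrightarrow> H i \<in> carrier_mat (nn i) (nn i)"
    and P: "P \<in> carrier_mat n n"
    and Pinv: "Pinv \<in> carrier_mat n n" "inverts_mat P Pinv" "inverts_mat Pinv P"
    and diag: "Pinv * A * P = diag_block_mat
      (lam_hat \<cdot>\<^sub>m 1\<^sub>m (nn 1) # map (\<lambda>i. mk_dual_mat (J i) (H i)) [2..<Suc m])"
    and U: "\<And>i. i \<in> {1..m} \<Longrightarrow>
      U i = mat n (nn i) (\<lambda>(r, c). P $$ (r, (\<Sum>j\<in>{1..<i}. nn j) + c))"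
    \<comment> \<open>the initial vector\<close>
    and v0: "v 0 \<in> carrier_vec n"
    and eta: "\<And>j. j \<in> {1..m} \<Longrightarrow> eta j \<in> carrier_vec (nn j)"
    and v0_eq: "v 0 = vec n (\<lambda>r. \<Sum>j\<in>{1..m}. (U j *\<^sub>v eta j) $ r)"
    and eta_1: "appreciable_vec (eta 1)"
    \<comment> \<open>the power method\<close>
    and B: "B = dq_adjoint A"
    and w0: "w 0 = dq_vec_adj (v 0)"
    and y: "\<And>k. k \<ge> 1 \<Longrightarrow> y k = B *\<^sub>v w (k - 1)"
    and lamk: "\<And>k. k \<ge> 1 \<Longrightarrow> lamk (k - 1) = scalar_prod (conjugate (w (k - 1))) (y k)"
    and w: "\<And>k. k \<ge> 1 \<Longrightarrow> w k = y k \<cdot>\<^sub>r inverse (dual_norm2 (y k))"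
    and v: "\<And>k. k \<ge> 1 \<Longrightarrow> v k = dq_vec_adj_inv n (w k)"
  shows "(\<exists>e. (\<forall>k. e k \<in> carrier_vec n) \<and>
            Otilde_D_vec (cmod (lam 2 / lam 1)) e \<and>
            (\<forall>k. v k = ((U 1 *\<^sub>v eta 1) \<cdot>\<^sub>r inverse (dual_norm2 (U 1 *\<^sub>v eta 1)))
                          \<cdot>\<^sub>r (lam_hat / dual_abs lam_hat) ^ k + e k)) \<and>
         (\<exists>e. Otilde_D (cmod (lam 2 / lam 1)) e \<and>
            (\<forall>k. DQ_of_DC (lamk k) = lam_hat * (1 + e k)))"
proof -
  obtain a b where lam_hat: "lam_hat = real_dual a b"
    using lam1_real by (rule Dual_Reals_cases)
  have "quat1 (of_real a) = quat1 (quat_of_complex (lam 1))"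
    using lam1_std by (simp add: lam_hat)
  then have lam1: "lam 1 = of_real a" by (simp add: quat_of_complex_def)
  define r where "r = cmod (lam 2)"
  have r: "0 \<le> r" "r < \<bar>a\<bar>" using lam_dominant unfolding lam1 r_def by simp_all
  then have a: "a \<noteq> 0" by auto
  define c where "c = r / \<bar>a\<bar>"
  have c: "0 \<le> c" "c < 1" using r by (simp_all add: c_def)
  have c_eq: "cmod (lam 2 / lam 1) = c" by (simp only: c_def r_def lam1 norm_divide norm_of_real)

  define Ms where "Ms = map (\<lambda>i. mk_dual_mat (J i) (H i)) [2..<Suc m]"
  define D where "D = Pinv * A * P"
  have D: "D = diag_block_mat ((lam_hat \<cdot>\<^sub>m 1\<^sub>m (nn 1)) # Ms)" "D \<in> carrier_mat n n"
  proof -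
    show "D = diag_block_mat ((lam_hat \<cdot>\<^sub>m 1\<^sub>m (nn 1)) # Ms)"
      unfolding D_def Ms_def by (rule diag)
    show "D \<in> carrier_mat n n" using A P Pinv(1) by (simp add: D_def)
  qed
  have lam_le: "cmod (lam i) \<le> r" if "2 \<le> i" "i \<le> m" for i
    using that
  proof (induction i rule: dec_induct)
    case (step i)
    then show ?case using lam_order[of i] by simp
  qed (simp add: r_def)
  have Ms: "triangular_bounded r (std_mat M)" if M_in: "M \<in> set Ms" for M
  proof -
    obtain i where i: "2 \<le> i" "i \<le> m" and M: "M = mk_dual_mat (J i) (H i)"
      using M_in by (auto simp: Ms_def simp del: upt_Suc)
    have "std_mat M = jordan_part (lam i) bs" using J[of i] i by (simp add: M)
    then show ?thesis
      using triangular_bounded_jordan_part[of "lam i" bs] lam_le[OF i]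
      unfolding triangular_bounded_def by (auto intro: order.trans)
  qed
  note entries = block_diagonal_entries[OF D Ms]

  have n_eq: "n = (\<Sum>j\<in>{1..m}. nn j)"
  proof -
    have dim: "dim_row (mk_dual_mat (J i) (H i)) = nn i" if "i \<in> set [2..<Suc m]" for i
      using J[of i] that by auto
    have "n = dim_row D" using D(2) by simp
    also have "\<dots> = nn 1 + sum_list (map dim_row Ms)"
      unfolding D(1) dim_diag_block_mat by simp
    also have "map dim_row Ms = map nn [2..<Suc m]"
      unfolding Ms_def map_map by (rule map_cong[OF refl]) (simp only: o_apply dim)
    also have "nn 1 + sum_list (map nn [2..<Suc m]) = (\<Sum>j\<in>{1..m}. nn j)"
      using m by (simp add: sum.atLeast_Suc_atMost interv_sum_list_conv_sum_set_nat
          atLeastLessThanSuc_atLeastAtMost numeral_2_eq_2 del: upt_Suc)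
    finally show ?thesis .
  qed
  \<comment> \<open>The coordinates of the initial vector with respect to the columns of \<open>P\<close>.\<close>
  obtain zf where zf: "\<And>j c. j \<in> {1..m} \<Longrightarrow> c < nn j \<Longrightarrow> zf ((\<Sum>l\<in>{1..<j}. nn l) + c) = eta j $ c"
    using block_concat_exists[of m nn "\<lambda>j c. eta j $ c"] by blast
  define z where "z = vec n zf"
  have z: "z \<in> carrier_vec n" by (simp add: z_def)
  have U_mult: "(U j *\<^sub>v eta j) $ i = (\<Sum>c<nn j. P $$ (i, (\<Sum>l\<in>{1..<j}. nn l) + c) * eta j $ c)"
    if "j \<in> {1..m}" "i < n" for i j
    using U[OF that(1)] eta[OF that(1)] that(2) by (simp add: scalar_prod_def atLeast0LessThan)
  have Pz: "P *\<^sub>v z = v 0"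
  proof (rule eq_vecI)
    fix i assume "i < dim_vec (v 0)"
    then have i: "i < n" using v0 by simp
    have "(P *\<^sub>v z) $ i = (\<Sum>k<n. P $$ (i, k) * zf k)"
      using P i by (simp add: z_def scalar_prod_def atLeast0LessThan)
    also have "\<dots> = (\<Sum>j\<in>{1..m}. \<Sum>c<nn j. P $$ (i, (\<Sum>l\<in>{1..<j}. nn l) + c) * zf ((\<Sum>l\<in>{1..<j}. nn l) + c))"
      unfolding block_sum[where nn = nn and f = "\<lambda>k. P $$ (i, k) * zf k"] n_eq ..
    also have "\<dots> = (\<Sum>j\<in>{1..m}. (U j *\<^sub>v eta j) $ i)"
      using i by (intro sum.cong) (simp_all add: U_mult zf del: One_nat_def)
    also have "\<dots> = v 0 $ i" using i by (subst v0_eq) simp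
    finally show "(P *\<^sub>v z) $ i = v 0 $ i" .
  qed (use P v0 in auto)
  have one: "1 \<in> {1..m}" using m by simp
  have z_top: "z $ i = eta 1 $ i" if "i < nn 1" for i
    using zf[OF one that] that entries(1) by (simp add: z_def)
  \<comment> \<open>The component of the initial vector in the dominant eigenspace, in the same coordinates.\<close>
  define \<eta> where "\<eta> = vec n (\<lambda>i. if i < nn 1 then eta 1 $ i else 0)"
  have \<eta>: "\<eta> \<in> carrier_vec n" by (simp add: \<eta>_def)
  have P\<eta>: "P *\<^sub>v \<eta> = U 1 *\<^sub>v eta 1"
  proof (rule eq_vecI)
    fix i assume "i < dim_vec (U 1 *\<^sub>v eta 1)"
    then have i: "i < n" using U[OF one] by simp
    have "(P *\<^sub>v \<eta>) $ i = (\<Sum>k<n. P $$ (i, k) * (if k < nn 1 then eta 1 $ k else 0))"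
      using P i by (simp add: \<eta>_def scalar_prod_def atLeast0LessThan)
    also have "\<dots> = (\<Sum>k<nn 1. P $$ (i, k) * eta 1 $ k)"
      using entries(1) by (intro sum.mono_neutral_cong_right) auto
    also have "\<dots> = (U 1 *\<^sub>v eta 1) $ i"
      using i by (simp add: U_mult[OF one] del: One_nat_def)
    finally show "(P *\<^sub>v \<eta>) $ i = (U 1 *\<^sub>v eta 1) $ i" .
  qed (use P U[OF one] in auto)
  obtain i0 where i0: "i0 < nn 1" "std_part (z $ i0) \<noteq> 0"
    using eta_1 eta[OF one] by (auto simp: appreciable_vec_iff z_top)

  obtain X where X: "X 0 = P *\<^sub>v z" "\<And>k. X k \<in> carrier_vec n"
    "\<And>k. A *\<^sub>v X k = X (Suc k) \<cdot>\<^sub>r real_dual a b" "\<And>k. appreciable_vec (X k)"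
    and x: "A *\<^sub>v (P *\<^sub>v \<eta>) = (P *\<^sub>v \<eta>) \<cdot>\<^sub>r real_dual a b" "appreciable_vec (P *\<^sub>v \<eta>)"
    and rate: "\<And>i. i < n \<Longrightarrow> dual_converges_at_rate c (\<lambda>k. X k $ i) ((P *\<^sub>v \<eta>) $ i)"
    unfolding c_def
    by (rule block_diagonal_power_iteration[OF A P Pinv D_def[symmetric] a r
          entries(2)[unfolded lam_hat] entries(3,4,5,1) z \<eta> _ _ i0])
      (use entries(1) in \<open>simp_all add: \<eta>_def z_top\<close>)

  \<comment> \<open>The same method on quaternionic vectors, which \<open>dq_vec_adj\<close> carries to \<open>w\<close>.\<close>
  define u where "u = rec_nat (v 0) (\<lambda>_ x. normalize_dq (A *\<^sub>v x))"
  have u: "u 0 = X 0" "\<And>k. u (Suc k) = normalize_dq (A *\<^sub>v u k)"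
    by (simp_all add: u_def X(1) Pz)
  have Au: "appreciable_vec (A *\<^sub>v u k)" for k
    by (rule normalized_iteration_appreciable[OF A X(2) a X(3,4) u])
  have u0: "u 0 = v 0" by (simp add: u_def)
  have iterates: "w k = dq_vec_adj (u k)" "v k = u k" "y (Suc k) = dq_vec_adj (A *\<^sub>v u k)"
    "u k \<in> carrier_vec n" for k
    using adjoint_power_method[OF A v0 Au u0 u(2) w0 y[unfolded B] w v] by blast+
  have P\<eta>_carrier: "P *\<^sub>v \<eta> \<in> carrier_vec n" using P \<eta> by simp
  note limit = normalized_iteration_limit[OF A X(2) a X(3,4) u c P\<eta>_carrier x(2,1) rate]

  define x' where "x' = (U 1 *\<^sub>v eta 1) \<cdot>\<^sub>r inverse (dual_norm2 (U 1 *\<^sub>v eta 1))"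
  have x': "x' = normalize_dq (P *\<^sub>v \<eta>)" "x' \<in> carrier_vec n"
    using normalize_dq_eq[OF x(2)] P\<eta>_carrier by (simp_all add: x'_def P\<eta>)
  have ratio: "(lam_hat / dual_abs lam_hat) ^ k = real_dual (sgn a ^ k) 0" for k
    by (simp add: lam_hat real_dual_over_dual_abs[OF a] real_dual_power)
  have "v k = x' \<cdot>\<^sub>r (lam_hat / dual_abs lam_hat) ^ k + (u k - x' \<cdot>\<^sub>r real_dual (sgn a ^ k) 0)" for k
    using iterates(4)[of k] x'(2) by (auto simp: iterates(2) ratio vec_eq_iff)
  moreover have "u k - x' \<cdot>\<^sub>r real_dual (sgn a ^ k) 0 \<in> carrier_vec n" for k
    using iterates(4) x'(2) by simp
  moreover have "Otilde_D_vec c (\<lambda>k. u k - x' \<cdot>\<^sub>r real_dual (sgn a ^ k) 0)"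
    using limit(1) by (simp add: x'(1))
  ultimately have vectors: "\<exists>e. (\<forall>k. e k \<in> carrier_vec n) \<and> Otilde_D_vec c e \<and>
      (\<forall>k. v k = x' \<cdot>\<^sub>r (lam_hat / dual_abs lam_hat) ^ k + e k)"
    by (intro exI[of _ "\<lambda>k. u k - x' \<cdot>\<^sub>r real_dual (sgn a ^ k) 0"]) simp

  \<comment> \<open>The estimates are the complex components of \<open>u\<^sub>k\<^sup>* A u\<^sub>k\<close>, and \<open>\<lambda>\<^sub>1\<close> is real.\<close>
  let ?\<phi> = "map_dualnum (\<lambda>q. quat_of_complex (quat1 q))"
  have "lamk k = scalar_prod (conjugate (w k)) (y (Suc k))" for k
    using lamk[of "Suc k"] by simp
  then have lamk_eq: "DQ_of_DC (lamk k) = ?\<phi> (scalar_prod (conjugate (u k)) (A *\<^sub>v u k))" for k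
    using iterates(4)[of k] A by (simp add: iterates DQ_of_DC_scalar_prod)
  have "?\<phi> lam_hat = lam_hat"
    by (simp add: lam_hat dualnum_eq_iff dualnum.map_sel quat_of_complex_def quat_eq_iff)
  then have "dual_converges_at_rate c (\<lambda>k. DQ_of_DC (lamk k)) lam_hat"
    using complex_part_converges_at_rate[OF c(1) limit(2)] by (simp add: lamk_eq lam_hat)
  then have "dual_converges_at_rate c (\<lambda>k. inverse lam_hat * DQ_of_DC (lamk k)) (inverse lam_hat * lam_hat)"
    using c by (intro dual_converges_at_rate_mult dual_converges_at_rate_const) simp_all
  moreover have inv: "inverse lam_hat * lam_hat = 1" "lam_hat * inverse lam_hat = 1"
    using a by (simp_all add: lam_hat dualnum_inverse)
  ultimately have "Otilde_D c (\<lambda>k. inverse lam_hat * DQ_of_DC (lamk k) - 1)"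
    by (simp add: dual_converges_at_rate_iff_Otilde_D)
  moreover have "DQ_of_DC (lamk k) = lam_hat * (1 + (inverse lam_hat * DQ_of_DC (lamk k) - 1))" for k
    using inv(2) by (simp flip: mult.assoc)
  ultimately have eigenvalues: "\<exists>e. Otilde_D c e \<and> (\<forall>k. DQ_of_DC (lamk k) = lam_hat * (1 + e k))"
    by (intro exI[of _ "\<lambda>k. inverse lam_hat * DQ_of_DC (lamk k) - 1"]) simp
  show ?thesis
    unfolding c_eq using vectors eigenvalues unfolding x'_def by blast
qed

end
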